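(* Let $a,b,c,\mu\in\mathbb{C}$ with $c,\,c-\mu\notin\mathbb{Z}_{\le0}$, $\operatorname{Re}a>\operatorname{Re}\mu>0$ and $\operatorname{Re}(c-b)>\operatorname{Re}\mu$. Then for all real $x<1$ $$\int_x^1(1-y)^{a-\mu-1}\,{}_2F_1(a,b;c;y)\,\frac{(y-x)^{\mu-1}}{\Gamma(\mu)}\,dy=\frac{\Gamma(a-\mu)}{\Gamma(a)}\,\frac{\Gamma(c-b-\mu)}{\Gamma(c-b)}\,\frac{\Gamma(c)}{\Gamma(c-\mu)}\,(1-x)^{a-1}\,{}_2F_1(a-\mu,b;c-\mu;x).$$
   Context: ${}_2F_1(a,b;c;z)$ denotes the Gauss hypergeometric function, defined for $|z|<1$ by $\sum_{k\ge0}\frac{(a)_k(b)_k}{(c)_k\,k!}z^k$ (with $c\notin\mathbb{Z}_{\le0}$) and extended by its one-valued analytic continuation to $\mathbb{C}\setminus[1,\infty)$. *)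

theory Defs
  imports "HOL-Complex_Analysis.Complex_Analysis"
begin

definition hyp2F1_series :: "complex \<Rightarrow> complex \<Rightarrow> complex \<Rightarrow> complex \<Rightarrow> complex" where
  "hyp2F1_series a b c z =
     (\<Sum>k. pochhammer a k * pochhammer b k / (pochhammer c k * fact k) * z ^ k)"

definition slit_plane :: "complex set" where
  "slit_plane = UNIV - complex_of_real ` {1..}"

text \<open>
  The value at \<open>z\<close> of the analytic continuation of the Gauss series from the unit disc to the
  slit plane. The plane cut along \<open>[1,\<infinity>)\<close> is connected, so any two continuations agree on it and
  the description is unambiguous for \<open>z\<close> in the slit plane; on the cut the value is unspecified.
\<close>
definition hyp2F1 :: "complex \<Rightarrow> complex \<Rightarrow> complex \<Rightarrow> complex \<Rightarrow> complex" where
  "hyp2F1 a b c z =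
     (THE w. \<exists>f. f holomorphic_on slit_plane \<and>
                 (\<forall>u. norm u < 1 \<longrightarrow> f u = hyp2F1_series a b c u) \<and> w = f z)"

end

theory Submission
  imports Defs
begin

text \<open>
  For \<open>Re b > 0\<close> insert Euler's integral
  \<open>B(b, c-b) F(a,b;c;y) = \<integral>\<^sub>0\<^sup>1 s^(b-1) (1-s)^(c-b-1) (1-ys)^(-a) ds\<close> and swap the integrals. The substitution
  \<open>u = (1-s)(y-x) / ((1-x)(1-sy))\<close> turns the \<open>y\<close>-integral into a Beta integral, and what remains is
  Euler's integral for \<open>F(a-\<mu>,b;c-\<mu>;x)\<close>.

  The general case descends to this one by the relation
  \<open>c F(a,b;c;y) = (c-ay) f(y) + y(1-y) f'(y)\<close> with \<open>f = F(a,b+1;c+1;\<cdot>)\<close>, which keeps \<open>c-b\<close> fixed. Up to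
  the derivative of \<open>(y-x)^\<mu> (1-y)^(a-\<mu>) f(y)\<close>, which integrates to zero, the fractional integral carries
  it to the same relation for the parameters \<open>a-\<mu>, b, c-\<mu>\<close>. The relation also yields the analytic
  continuation to the slit plane whenever \<open>Re (c-b) > 0\<close>.
\<close>

subsection \<open>Holomorphic parameter integrals and the complex Beta integral\<close>

text \<open>Euler's integral diverges at \<open>s = 0\<close> unless \<open>Re b > 0\<close>, while
  the theorem bounds \<open>Re b\<close> only from above, by \<open>Re (c - b) > Re \<mu>\<close>. A
  descent that holds \<open>c - b\<close> fixed preserves this inequality at every instance it
  calls. The derivative of \<open>F(a,b+1;c+1)\<close> is \<open>a (b+1) / (c+1)\<close> times
  \<open>F(a+1,b+2;c+2)\<close>, so each step calls two instances, one with \<open>a\<close> raised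
  by 1; hence \<open>a\<close>, \<open>b\<close>, \<open>c\<close> all vary in the inductions while
  \<mu> stays. The exponent \<open>-a\<close> of Euler's kernel is what lets the substitution
  succeed: with \<open>p = \<mu>\<close> and \<open>q = a - \<mu>\<close>, a Moebius map contributes
  the exponents \<open>p - 1\<close> and \<open>q - 1\<close>, plus 2 from its derivative, to the
  linear factor \<open>1 - s y\<close>, in total \<open>-(p + q) = -a\<close>. Since
  \<open>Re (a - \<mu>)\<close> exceeds both 0 and \<open>Re (a + b - c)\<close>, an exponent
  \<open>s > 0\<close> fits with \<open>Re (a + b - c) \<le> s < Re (a - \<mu>)\<close>. The
  function grows at 1 at most like the power \<open>-s\<close> of \<open>1 - y\<close>, and this one
  estimate gives both the integrability and the vanishing of the boundary terms.\<close>

text \<open>A local bound on \<open>g\<close> alone suffices: Cauchy's inequality on circles of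
  radius \<open>r\<close> turns it into the bound \<open>h s / r\<close> for the derivative, hence
  for the difference quotients, and dominated convergence applies along every sequence tending to
  \<open>z0\<close>.\<close>

lemma holomorphic_on_dominated_integral:
  fixes g :: "complex \<Rightarrow> 'a \<Rightarrow> complex"
  assumes S: "open S"
    and meas: "\<And>z. z \<in> S \<Longrightarrow> g z \<in> borel_measurable M"
    and hol: "\<And>s. s \<in> space M \<Longrightarrow> (\<lambda>z. g z s) holomorphic_on S"
    and dom: "\<And>z0. z0 \<in> S \<Longrightarrow>
      \<exists>r>0. \<exists>h. integrable M h \<and> (\<forall>z\<in>ball z0 r \<inter> S. \<forall>s\<in>space M. norm (g z s) \<le> h s)"
  shows "(\<lambda>z. integral\<^sup>L M (g z)) holomorphic_on S"
proof (rule holomorphic_onI)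
  fix z0 assume z0: "z0 \<in> S"
  obtain r0 h where r0: "r0 > 0" and h: "integrable M h"
    and bd: "\<And>z s. z \<in> ball z0 r0 \<inter> S \<Longrightarrow> s \<in> space M \<Longrightarrow> norm (g z s) \<le> h s"
    using dom[OF z0] by blast
  obtain r1 where r1: "r1 > 0" "ball z0 r1 \<subseteq> S"
    using S z0 open_contains_ball by blast
  \<comment> \<open>A third, so that a disc of radius \<open>r\<close> about any point of
    \<open>ball z0 r\<close> stays where \<open>g\<close> is holomorphic and dominated.\<close>
  define r where "r = min r0 r1 / 3"
  have r: "r > 0" using r0 r1 by (simp add: r_def)
  have rS: "z \<in> ball z0 r0 \<inter> S" if "z \<in> ball z0 (3*r)" for z
  proof -
    have "ball z0 (3*r) \<subseteq> ball z0 r0 \<inter> ball z0 r1" by (auto simp: r_def)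
    with that r1(2) show ?thesis by blast
  qed
  have int: "integrable M (g z)" if "z \<in> ball z0 (3*r)" for z
  proof (rule Bochner_Integration.integrable_bound[OF h])
    show "g z \<in> borel_measurable M" using rS[OF that] meas by blast
    show "AE s in M. norm (g z s) \<le> norm (h s)"
    proof (rule AE_I2)
      fix s assume "s \<in> space M"
      from bd[OF rS[OF that] this] show "norm (g z s) \<le> norm (h s)" by simp
    qed
  qed
  have lip: "norm (g z s - g z0 s) \<le> h s / r * norm (z - z0)"
    if z: "z \<in> ball z0 r" and s: "s \<in> space M" for z s
  proof (rule field_differentiable_bound[of "ball z0 r"])
    fix w assume w: "w \<in> ball z0 r"
    have sub: "cball w r \<subseteq> ball z0 (3*r)"
    proof
      fix u assume "u \<in> cball w r"
      thus "u \<in> ball z0 (3*r)" using w r dist_triangle[of z0 u w] by (auto simp: dist_commute)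
    qed
    have holw: "(\<lambda>z. g z s) holomorphic_on ball z0 (3*r)"
      by (rule holomorphic_on_subset[OF hol[OF s]]) (use rS in blast)
    show "((\<lambda>z. g z s) has_field_derivative deriv (\<lambda>z. g z s) w) (at w within ball z0 r)"
      by (rule has_field_derivative_at_within, rule holomorphic_derivI[OF holw])
         (use w r in auto)
    have "norm ((deriv ^^ 1) (\<lambda>z. g z s) w) \<le> fact 1 * h s / r ^ 1"
    proof (rule Cauchy_inequality)
      show "(\<lambda>z. g z s) holomorphic_on ball w r"
        by (rule holomorphic_on_subset[OF holw]) (use sub ball_subset_cball in blast)
      show "continuous_on (cball w r) (\<lambda>z. g z s)"
        by (rule holomorphic_on_imp_continuous_on[OF holomorphic_on_subset[OF holw sub]])
      show "norm (g u s) \<le> h s" if "norm (w - u) = r" for u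
      proof -
        have "u \<in> cball w r" using that by (simp add: dist_norm)
        thus ?thesis using bd[OF rS s] sub by blast
      qed
    qed (use r in auto)
    thus "norm (deriv (\<lambda>z. g z s) w) \<le> h s / r" by simp
  qed (use z r in auto)
  have "((\<lambda>z. integral\<^sup>L M (g z)) has_field_derivative
         (\<integral>s. deriv (\<lambda>z. g z s) z0 \<partial>M)) (at z0)"
    unfolding has_field_derivative_iff LIMSEQ_SEQ_conv[symmetric]
  proof (intro allI impI, elim conjE)
    fix X :: "nat \<Rightarrow> complex" assume X: "\<forall>n. X n \<noteq> z0" "X \<longlonglongrightarrow> z0"
    obtain N where N: "\<And>n. n \<ge> N \<Longrightarrow> dist (X n) z0 < r"
      using X(2) r unfolding lim_sequentially by blast
    \<comment> \<open>Dropping an initial segment makes the Lipschitz bound available for every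
      term.\<close>
    define Y where "Y n = X (n + N)" for n
    have Y: "Y \<longlonglongrightarrow> z0" "\<And>n. Y n \<noteq> z0" "\<And>n. Y n \<in> ball z0 r"
      using X N LIMSEQ_ignore_initial_segment[OF X(2), of N]
      by (auto simp: Y_def[abs_def] dist_commute)
    have Y3: "Y n \<in> ball z0 (3*r)" for n using Y(3)[of n] r by auto
    have lim: "(\<lambda>n. (g (Y n) s - g z0 s) / (Y n - z0)) \<longlonglongrightarrow> deriv (\<lambda>z. g z s) z0"
      if s: "s \<in> space M" for s
    proof -
      have "((\<lambda>z. g z s) has_field_derivative deriv (\<lambda>z. g z s) z0) (at z0)"
        by (rule holomorphic_derivI[OF hol[OF s] S z0])
      thus ?thesis
        unfolding has_field_derivative_iff LIMSEQ_SEQ_conv[symmetric] using Y by blast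
    qed
    have [measurable]: "(\<lambda>s. (g (Y n) s - g z0 s) / (Y n - z0)) \<in> borel_measurable M" for n
      using meas[OF z0] meas[of "Y n"] rS[OF Y3[of n]] by auto
    have "(\<lambda>n. \<integral>s. (g (Y n) s - g z0 s) / (Y n - z0) \<partial>M)
            \<longlonglongrightarrow> (\<integral>s. deriv (\<lambda>z. g z s) z0 \<partial>M)"
    proof (rule integral_dominated_convergence[where w = "\<lambda>s. h s / r"])
      show "(\<lambda>s. deriv (\<lambda>z. g z s) z0) \<in> borel_measurable M"
        by (rule borel_measurable_LIMSEQ_metric[OF _ lim]) auto
      show "AE s in M. norm ((g (Y n) s - g z0 s) / (Y n - z0)) \<le> h s / r" for n
      proof (rule AE_I2)
        fix s assume "s \<in> space M"
        from lip[OF Y(3) this, of n] Y(2)[of n]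
        show "norm ((g (Y n) s - g z0 s) / (Y n - z0)) \<le> h s / r"
          by (simp add: norm_divide divide_le_eq)
      qed
    qed (use h lim in auto)
    moreover have "(\<integral>s. (g (Y n) s - g z0 s) / (Y n - z0) \<partial>M)
        = (integral\<^sup>L M (g (Y n)) - integral\<^sup>L M (g z0)) / (Y n - z0)" for n
      using int[OF Y3[of n]] int[of z0] r by simp
    ultimately have "(\<lambda>n. (integral\<^sup>L M (g (Y n)) - integral\<^sup>L M (g z0)) / (Y n - z0))
            \<longlonglongrightarrow> (\<integral>s. deriv (\<lambda>z. g z s) z0 \<partial>M)" by (simp only:)
    thus "(\<lambda>n. (integral\<^sup>L M (g (X n)) - integral\<^sup>L M (g z0)) / (X n - z0))
            \<longlonglongrightarrow> (\<integral>s. deriv (\<lambda>z. g z s) z0 \<partial>M)"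
      unfolding Y_def by (rule LIMSEQ_offset)
  qed
  thus "(\<lambda>z. integral\<^sup>L M (g z)) field_differentiable at z0 within S"
    using field_differentiable_at_within field_differentiable_def by blast
qed

lemma of_real_powr_eq_exp:
  "t > 0 \<Longrightarrow> complex_of_real t powr p = exp (p * of_real (ln t))"
  by (simp add: powr_def Ln_of_real)

lemma norm_of_real_powr:
  "t \<ge> 0 \<Longrightarrow> norm (complex_of_real t powr p) = t powr Re p"
  by (simp add: norm_powr_real_powr)

lemma continuous_on_of_real_powr:
  assumes "continuous_on A f" "\<And>x. x \<in> A \<Longrightarrow> f x > 0"
  shows "continuous_on A (\<lambda>x. complex_of_real (f x) powr p)"
proof -
  have "continuous_on A (\<lambda>x. exp (p * of_real (ln (f x))))"
    using assms by (intro continuous_intros) (auto simp: less_imp_neq[symmetric])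
  thus ?thesis
    by (rule continuous_on_eq) (simp add: of_real_powr_eq_exp assms)
qed

lemma set_integrable_continuous_bound:
  fixes f :: "real \<Rightarrow> complex" and h :: "real \<Rightarrow> real"
  assumes "open A" "continuous_on A f" "set_integrable lborel A h"
    and "\<And>x. x \<in> A \<Longrightarrow> norm (f x) \<le> h x"
  shows "set_integrable lborel A f"
proof (rule set_integrable_bound[OF assms(3)])
  show "set_borel_measurable lborel A f"
    unfolding set_borel_measurable_def
    using borel_measurable_continuous_on_indicator[OF _ assms(2)] assms(1) by auto
  show "AE x in lborel. x \<in> A \<longrightarrow> norm (f x) \<le> norm (h x)"
    using assms(4) by (intro AE_I2) (auto intro: order_trans[OF _ abs_ge_self])
qed

lemma set_integrable_Beta:
  fixes p q :: real
  assumes "p > 0" "q > 0"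
  shows "set_integrable lborel {0<..<1} (\<lambda>s. s powr (p - 1) * (1 - s) powr (q - 1))"
  by (rule set_integrable_subset[OF integrable_Beta[OF assms]]) auto

lemma set_integrable_Beta_complex:
  assumes "Re p > 0" "Re q > 0"
  shows "set_integrable lborel {0<..<1}
           (\<lambda>s. complex_of_real s powr (p - 1) * of_real (1 - s) powr (q - 1))"
  by (rule set_integrable_continuous_bound[OF _ _ set_integrable_Beta[OF assms]])
     (auto intro!: continuous_intros continuous_on_of_real_powr 
           simp: norm_mult norm_of_real_powr simp del: of_real_diff)

lemma Beta_integral_commute:
  "(LINT s:{0<..<1}|lborel. complex_of_real s powr (p - 1) * of_real (1 - s) powr (q - 1)) =
   (LINT s:{0<..<1}|lborel. complex_of_real s powr (q - 1) * of_real (1 - s) powr (p - 1))"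
proof -
  have "(LINT s:{0<..<1}|lborel. complex_of_real s powr (p - 1) * of_real (1 - s) powr (q - 1)) =
     (LINT s|lborel. indicator {0<..<1} (1 + (-1) * s) *\<^sub>R
        (complex_of_real (1 + (-1) * s) powr (p - 1) * of_real (1 - (1 + (-1) * s)) powr (q - 1)))"
    unfolding set_lebesgue_integral_def
    by (subst lborel_integral_real_affine[where c = "-1" and t = 1]) simp_all
  also have "\<dots> = (LINT s:{0<..<1}|lborel.
      complex_of_real s powr (q - 1) * of_real (1 - s) powr (p - 1))"
    unfolding set_lebesgue_integral_def
    by (intro Bochner_Integration.integral_cong refl) (auto simp: indicator_def)
  finally show ?thesis .
qed

lemma holomorphic_on_Beta_integral:
  assumes "Re q > 0"
  shows "(\<lambda>p. LINT s:{0<..<1}|lborel.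
           complex_of_real s powr (p - 1) * of_real (1 - s) powr (q - 1)) holomorphic_on {p. Re p > 0}"
  unfolding set_lebesgue_integral_def
proof (rule holomorphic_on_dominated_integral)
  show "open {p. Re p > 0}" by (rule open_halfspace_Re_gt)
  show "(\<lambda>s. indicator {0<..<1} s *\<^sub>R
      (complex_of_real s powr (p - 1) * of_real (1 - s) powr (q - 1))) \<in> borel_measurable lborel"
    if "p \<in> {p. Re p > 0}" for p
    using set_integrable_Beta_complex[of p q] that assms
    by (auto simp: set_integrable_def dest: borel_measurable_integrable)
  show "(\<lambda>p. indicator {0<..<1} s *\<^sub>R
      (complex_of_real s powr (p - 1) * of_real (1 - s) powr (q - 1))) holomorphic_on {p. Re p > 0}"
    for s :: real
  proof (cases "s \<in> {0<..<1}")
    case True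
    thus ?thesis by (auto intro!: holomorphic_intros)
  qed auto
next
  fix p0 :: complex assume p0: "p0 \<in> {p. Re p > 0}"
  \<comment> \<open>On the ball of radius \<open>Re p0 / 2\<close> the real part stays at least
    \<open>Re p0 / 2\<close>, and for \<open>s < 1\<close> the smallest exponent gives the largest
    power.\<close>
  let ?h = "\<lambda>s. indicator {0<..<1} s *\<^sub>R (s powr (Re p0 / 2 - 1) * (1 - s) powr (Re q - 1))"
  have "integrable lborel ?h"
    using set_integrable_Beta[of "Re p0 / 2" "Re q"] p0 assms by (simp add: set_integrable_def)
  moreover have "norm (indicator {0<..<1} s *\<^sub>R
      (complex_of_real s powr (p - 1) * of_real (1 - s) powr (q - 1))) \<le> ?h s"
    if p: "p \<in> ball p0 (Re p0 / 2) \<inter> {p. Re p > 0}" for p s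
  proof (cases "s \<in> {0<..<1}")
    case True
    have "\<bar>Re (p0 - p)\<bar> < Re p0 / 2"
      using p abs_Re_le_cmod[of "p0 - p"] by (simp add: dist_norm)
    hence "Re p0 / 2 \<le> Re p" unfolding minus_complex.sel by linarith
    hence "s powr (Re p - 1) \<le> s powr (Re p0 / 2 - 1)"
      using True by (intro powr_mono') auto
    thus ?thesis using True
      by (auto simp: norm_mult norm_of_real_powr simp del: of_real_diff intro!: mult_right_mono)
  qed auto
  ultimately show "\<exists>r>0. \<exists>h. integrable lborel h \<and>
      (\<forall>p\<in>ball p0 r \<inter> {p. Re p > 0}. \<forall>s\<in>space lborel. norm (indicator {0<..<1} s *\<^sub>R
      (complex_of_real s powr (p - 1) * of_real (1 - s) powr (q - 1))) \<le> h s)"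
    using p0 by (intro exI[of _ "Re p0 / 2"] exI[of _ ?h] conjI ballI) auto
qed

lemma one_islimpt_positive_reals: "(1::complex) islimpt of_real ` {0<..}"
  unfolding islimpt_approachable
proof (intro allI impI)
  fix e :: real assume "e > 0"
  thus "\<exists>x'\<in>complex_of_real ` {0<..}. x' \<noteq> 1 \<and> dist x' 1 < e"
    by (intro bexI[of _ "of_real (1 + e/2)"] conjI imageI) (auto simp: dist_norm)
qed

text \<open>Identity theorem; the positive reals accumulate at the interior point 1.\<close>

lemma eq_on_right_halfplane:
  assumes "f holomorphic_on {p. Re p > 0}" "g holomorphic_on {p. Re p > 0}"
    and "\<And>t. t > 0 \<Longrightarrow> f (of_real t) = g (of_real t)" and "Re p > 0"
  shows "f p = g p"
proof -
  have "f p - g p = 0"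
    by (rule analytic_continuation[where S = "{p. Re p > 0}" and f = "\<lambda>p. f p - g p" and
              U = "of_real ` {0<..}", OF _ _ _ _ _ one_islimpt_positive_reals])
       (use assms in \<open>auto intro!: holomorphic_intros open_halfspace_Re_gt convex_connected
          convex_halfspace_Re_gt\<close>)
  thus ?thesis by simp
qed

lemma Beta_integral_of_real:
  assumes "p > 0" "q > 0"
  shows "(LINT s:{0<..<1}|lborel. complex_of_real s powr (of_real p - 1) *
            of_real (1 - s) powr (of_real q - 1)) = Beta (of_real p) (of_real q)"
proof -
  have "(LINT s:{0<..<1}|lborel. complex_of_real s powr (of_real p - 1) *
            of_real (1 - s) powr (of_real q - 1)) =
        (LINT s:{0<..<1}|lborel. complex_of_real (s powr (p - 1) * (1 - s) powr (q - 1)))"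
  proof (intro set_lebesgue_integral_cong allI impI)
    fix s :: real assume "s \<in> {0<..<1}"
    thus "complex_of_real s powr (of_real p - 1) * of_real (1 - s) powr (of_real q - 1) =
        complex_of_real (s powr (p - 1) * (1 - s) powr (q - 1))"
      using powr_of_real[of s "p - 1"] powr_of_real[of "1 - s" "q - 1"] by simp
  qed auto
  also have "\<dots> = of_real (LINT s:{0<..<1}|lborel. s powr (p - 1) * (1 - s) powr (q - 1))"
    by (rule set_integral_complex_of_real)
  also have "(LINT s:{0<..<1}|lborel. s powr (p - 1) * (1 - s) powr (q - 1)) = Beta p q"
    using set_borel_integral_eq_integral(2)[OF set_integrable_Beta[OF assms]]
      integral_unique[OF has_integral_Beta_real[OF assms]]
    by (simp add: integral_open_interval_real)
  finally show ?thesis by (simp add: Beta_complex_of_real)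
qed

lemma holomorphic_on_Beta_left:
  assumes "Re q > 0"
  shows "(\<lambda>p. Beta p q) holomorphic_on {p. Re p > 0}"
proof -
  have "p \<notin> \<int>\<^sub>\<le>\<^sub>0" if "Re p > 0" for p :: complex
    using that by (auto elim!: nonpos_Ints_cases)
  thus ?thesis
    unfolding Beta_altdef using assms by (auto intro!: holomorphic_intros)
qed

text \<open>Continuation from real exponents in one variable at a time: first \<open>p\<close> with
  \<open>q\<close> real, then \<open>q\<close> with \<open>p\<close> complex, the reflection
  \<open>s\<close> to \<open>1 - s\<close> letting the same holomorphy lemma serve both
  times.\<close>

lemma Beta_integral_complex:
  assumes "Re p > 0" "Re q > 0"
  shows "(LINT s:{0<..<1}|lborel.
           complex_of_real s powr (p - 1) * of_real (1 - s) powr (q - 1)) = Beta p q"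
proof -
  have *: "(LINT s:{0<..<1}|lborel. complex_of_real s powr (p - 1) *
      of_real (1 - s) powr (of_real t - 1)) = Beta p (of_real t)" if "t > 0" "Re p > 0" for t p
    by (rule eq_on_right_halfplane[OF holomorphic_on_Beta_integral holomorphic_on_Beta_left
          Beta_integral_of_real \<open>Re p > 0\<close>]) (use that in auto)
  show ?thesis
    unfolding Beta_integral_commute[of p q] Beta_commute[of p q]
    by (rule eq_on_right_halfplane[OF holomorphic_on_Beta_integral holomorphic_on_Beta_left
          _ \<open>Re q > 0\<close>])
       (use assms * in \<open>auto simp: Beta_integral_commute[of _ p] Beta_commute[of _ p] 
           simp del: of_real_diff\<close>)
qed

subsection \<open>Coefficients of the Gauss series\<close>

lemma Re_pos_imp_notin_nonpos_Ints: "Re p > 0 \<Longrightarrow> p \<notin> \<int>\<^sub>\<le>\<^sub>0"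
  by (auto elim!: nonpos_Ints_cases)

definition hyp2F1_coeff :: "complex \<Rightarrow> complex \<Rightarrow> complex \<Rightarrow> nat \<Rightarrow> complex" where
  "hyp2F1_coeff a b c k = pochhammer a k * pochhammer b k / (pochhammer c k * fact k)"

lemma hyp2F1_series_altdef: "hyp2F1_series a b c z = (\<Sum>k. hyp2F1_coeff a b c k * z ^ k)"
  by (simp add: hyp2F1_series_def hyp2F1_coeff_def)

lemma binomial_series_complex:
  fixes z :: complex
  assumes "norm z < 1"
  shows "(\<lambda>k. pochhammer a k / fact k * z ^ k) sums (1 - z) powr (-a)"
proof -
  have "(\<lambda>k. (-a gchoose k) * (-z) ^ k) sums (1 + (-z)) powr (-a)"
    by (rule gen_binomial_complex) (use assms in simp)
  moreover have "(-a gchoose k) * (-z) ^ k = pochhammer a k / fact k * z ^ k" for k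
  proof -
    have "(-1)^k * (-z)^k = z^k" by (simp flip: power_mult_distrib)
    thus ?thesis by (simp add: gbinomial_pochhammer field_simps)
  qed
  ultimately show ?thesis by simp
qed

lemma binomial_series_real:
  fixes y :: real
  assumes "\<bar>y\<bar> < 1"
  shows "(\<lambda>k. pochhammer s k / fact k * y ^ k) sums (1 - y) powr (-s)"
proof -
  have "(\<lambda>k. (-s gchoose k) * (-y) ^ k) sums (1 + (-y)) powr (-s)"
    by (rule gen_binomial_real) (use assms in simp)
  moreover have "(-s gchoose k) * (-y) ^ k = pochhammer s k / fact k * y ^ k" for k
  proof -
    have "(-1)^k * (-y)^k = y^k" by (simp flip: power_mult_distrib)
    thus ?thesis by (simp add: gbinomial_pochhammer field_simps)
  qed
  ultimately show ?thesis by simp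
qed

lemma pochhammer_eq_rGamma_series:
  "pochhammer z (Suc n) = rGamma_series z n * (fact n * exp (z * of_real (ln (of_nat n))))"
  for z :: complex
  by (simp add: rGamma_series_def)

text \<open>
  By Gauss's product for the Gamma function, \<open>(a)\<^sub>k (b)\<^sub>k / ((c)\<^sub>k (s)\<^sub>k)\<close> grows like \<open>k powr Re (a + b - c - s)\<close>,
  so the Gauss series is dominated by the binomial series of \<open>(1 - y) powr (-s)\<close>.
\<close>

lemma hyp2F1_coeff_bound:
  assumes c: "c \<notin> \<int>\<^sub>\<le>\<^sub>0" and s: "s > 0" "Re (a + b - c) \<le> s"
  shows "\<exists>C>0. \<forall>k. norm (hyp2F1_coeff a b c k) \<le> C * (pochhammer s k / fact k)"
proof -
  let ?s = "complex_of_real s"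
  have s': "?s \<notin> \<int>\<^sub>\<le>\<^sub>0" using s by (intro Re_pos_imp_notin_nonpos_Ints) simp
  define R where "R n = rGamma_series a n * rGamma_series b n / (rGamma_series c n * rGamma_series ?s n)" for n
  define L where "L n = exp ((a + b - c - ?s) * of_real (ln (of_nat n)))" for n :: nat
  \<comment> \<open>The reciprocal Gamma function is entire, and the denominators have nonzero
    limits because \<open>c\<close> and \<open>s\<close> are not poles of Gamma.\<close>
  have "R \<longlonglongrightarrow> rGamma a * rGamma b / (rGamma c * rGamma ?s)"
    unfolding R_def by (intro tendsto_intros) (use c s' in \<open>auto simp: rGamma_eq_zero_iff\<close>)
  hence "Bseq R" by (intro convergent_imp_Bseq convergentI)
  \<comment> \<open>The exponent has nonpositive real part and \<open>ln n\<close> is nonnegative;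
    at \<open>n = 0\<close> the convention \<open>ln 0 = 0\<close> gives
    \<open>L 0 = 1\<close>.\<close>
  moreover have "norm (L n) \<le> 1" for n
    using s(2) by (cases n) (auto simp: L_def intro!: mult_nonpos_nonneg)
  ultimately obtain K where K: "K > 0" "\<And>n. norm (R n) \<le> K"
    by (auto simp: Bseq_def)
  have RL: "norm (R n * L n) \<le> K" for n
    using mult_mono[OF K(2)[of n] \<open>norm (L n) \<le> 1\<close>] K(1) by (simp add: norm_mult)
  have *: "norm (hyp2F1_coeff a b c (Suc n)) \<le> K * (pochhammer s (Suc n) / fact (Suc n))" for n
  proof -
    have ne: "pochhammer c (Suc n) \<noteq> 0" "pochhammer ?s (Suc n) \<noteq> 0"
      using c s' by (auto dest: pochhammer_eq_0_imp_nonpos_Int)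
    have "hyp2F1_coeff a b c (Suc n) =
        (pochhammer a (Suc n) * pochhammer b (Suc n) / (pochhammer c (Suc n) * pochhammer ?s (Suc n)))
        * (pochhammer ?s (Suc n) / fact (Suc n))"
      using ne by (simp add: hyp2F1_coeff_def)
    also have "pochhammer a (Suc n) * pochhammer b (Suc n) / (pochhammer c (Suc n) * pochhammer ?s (Suc n))
       = R n * L n"
      unfolding pochhammer_eq_rGamma_series R_def L_def
      by (simp add: exp_add exp_diff ring_distribs left_diff_distrib mult_ac)
    also have "pochhammer ?s (Suc n) / fact (Suc n) = of_real (pochhammer s (Suc n) / fact (Suc n))"
      by (simp add: pochhammer_of_real)
    finally have "norm (hyp2F1_coeff a b c (Suc n))
        = norm (R n * L n) * (pochhammer s (Suc n) / fact (Suc n))"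
      using pochhammer_pos[OF s(1), of "Suc n"] abs_of_pos[of "pochhammer s (Suc n) / fact (Suc n)"]
      by (simp only: norm_mult norm_of_real) (simp del: fact_Suc)
    also have "\<dots> \<le> K * (pochhammer s (Suc n) / fact (Suc n))"
      using pochhammer_pos[OF s(1), of "Suc n"] by (intro mult_right_mono RL) auto
    finally show ?thesis .
  qed
  \<comment> \<open>The Gauss product only reaches indices \<open>Suc n\<close>; the coefficient at
    0 equals 1, which accounts for the \<open>max\<close>.\<close>
  have "norm (hyp2F1_coeff a b c k) \<le> max K 1 * (pochhammer s k / fact k)" for k
  proof (cases k)
    case (Suc n)
    have "K * (pochhammer s k / fact k) \<le> max K 1 * (pochhammer s k / fact k)"
      using pochhammer_pos[OF s(1), of k] by (intro mult_right_mono) auto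
    with *[of n] Suc show ?thesis by simp
  qed (simp add: hyp2F1_coeff_def)
  thus ?thesis by (intro exI[of _ "max K 1"]) auto
qed

text \<open>Termwise comparison with the binomial series. Allowing every positive \<open>s\<close>
  from \<open>Re (a + b - c)\<close> upwards avoids a separate treatment of logarithmic
  growth.\<close>

lemma hyp2F1_series_bound_real:
  assumes c: "c \<notin> \<int>\<^sub>\<le>\<^sub>0" and s: "s > 0" "Re (a + b - c) \<le> s"
  shows "\<exists>C>0. \<forall>y. 0 \<le> y \<and> y < 1 \<longrightarrow>
           norm (hyp2F1_series a b c (of_real y)) \<le> C * (1 - y) powr (-s)"
proof -
  obtain C where C: "C > 0" "\<And>k. norm (hyp2F1_coeff a b c k) \<le> C * (pochhammer s k / fact k)"
    using hyp2F1_coeff_bound[OF assms] by blast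
  have "norm (hyp2F1_series a b c (of_real y)) \<le> C * (1 - y) powr (-s)" if y: "0 \<le> y" "y < 1" for y
  proof -
    have "(\<lambda>k. C * (pochhammer s k / fact k * y ^ k)) sums (C * (1 - y) powr (-s))"
      by (intro sums_mult binomial_series_real) (use y in auto)
    moreover have "norm (hyp2F1_coeff a b c k * of_real y ^ k) \<le> C * (pochhammer s k / fact k * y ^ k)" for k
      using mult_right_mono[OF C(2)[of k], of "y ^ k"] y by (simp add: norm_mult norm_power mult_ac)
    ultimately show ?thesis
      unfolding hyp2F1_series_altdef
      using norm_suminf_le[of "\<lambda>k. hyp2F1_coeff a b c k * of_real y ^ k"
          "\<lambda>k. C * (pochhammer s k / fact k * y ^ k)"]
      by (simp only: sums_iff)
  qed
  with C(1) show ?thesis by blast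
qed

lemma summable_norm_hyp2F1:
  assumes "c \<notin> \<int>\<^sub>\<le>\<^sub>0" "norm z < 1"
  shows "summable (\<lambda>k. norm (hyp2F1_coeff a b c k * z ^ k))"
proof -
  define s where "s = max 1 (Re (a + b - c))"
  have "s > 0" "Re (a + b - c) \<le> s" by (auto simp: s_def)
  from hyp2F1_coeff_bound[OF assms(1) this] obtain C where
    C: "\<And>k. norm (hyp2F1_coeff a b c k) \<le> C * (pochhammer s k / fact k)" by blast
  have "summable (\<lambda>k. C * (pochhammer s k / fact k * norm z ^ k))"
    by (intro summable_mult sums_summable[OF binomial_series_real]) (use assms in auto)
  thus ?thesis
  proof (rule summable_comparison_test')
    fix k
    show "norm (norm (hyp2F1_coeff a b c k * z ^ k)) \<le> C * (pochhammer s k / fact k * norm z ^ k)"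
      using mult_right_mono[OF C[of k], of "norm z ^ k"] by (simp add: norm_mult norm_power mult_ac)
  qed
qed

lemma summable_hyp2F1:
  assumes "c \<notin> \<int>\<^sub>\<le>\<^sub>0" "norm z < 1"
  shows "summable (\<lambda>k. hyp2F1_coeff a b c k * z ^ k)"
  using summable_norm_cancel[OF summable_norm_hyp2F1[OF assms]] .

lemma sums_hyp2F1_series:
  assumes "c \<notin> \<int>\<^sub>\<le>\<^sub>0" "norm z < 1"
  shows "(\<lambda>k. hyp2F1_coeff a b c k * z ^ k) sums hyp2F1_series a b c z"
  unfolding hyp2F1_series_altdef by (rule summable_sums[OF summable_hyp2F1[OF assms]])

subsection \<open>Euler's integral\<close>

lemma slit_plane_iff: "z \<in> slit_plane \<longleftrightarrow> \<not> (Im z = 0 \<and> Re z \<ge> 1)"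
  by (auto simp: slit_plane_def image_iff complex_eq_iff)

lemma open_slit_plane: "open slit_plane"
proof -
  have "closed {z. Im z = 0 \<and> Re z \<ge> 1}"
    by (intro closed_Collect_conj closed_Collect_eq closed_Collect_le continuous_intros)
  moreover have "slit_plane = - {z. Im z = 0 \<and> Re z \<ge> 1}" by (auto simp: slit_plane_iff)
  ultimately show ?thesis by (metis open_Compl)
qed

lemma starlike_slit_plane: "starlike slit_plane"
  unfolding starlike_def
proof (intro bexI[of _ 0] ballI subsetI)
  fix z w assume z: "z \<in> slit_plane" and "w \<in> closed_segment 0 z"
  then obtain u where u: "0 \<le> u" "u \<le> 1" "w = of_real u * z"
    by (auto simp: closed_segment_def scaleR_conv_of_real)
  show "w \<in> slit_plane"
  proof (rule ccontr)
    assume "w \<notin> slit_plane"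
    hence w: "u * Im z = 0" "u * Re z \<ge> 1" using u by (auto simp: slit_plane_iff)
    hence "u > 0" using u by (cases "u = 0") auto
    hence "Re z > 0" using w by (smt (verit) zero_less_mult_pos)
    hence "u * Re z \<le> Re z" using u by (simp add: mult_left_le_one_le)
    thus False using w z \<open>u > 0\<close> by (auto simp: slit_plane_iff)
  qed
qed (simp add: slit_plane_iff)

lemma connected_slit_plane: "connected slit_plane"
  by (rule starlike_imp_connected[OF starlike_slit_plane])

lemma ball_subset_slit_plane: "ball 0 1 \<subseteq> slit_plane"
proof
  fix z :: complex assume "z \<in> ball 0 1"
  thus "z \<in> slit_plane" using complex_Re_le_cmod[of z] by (auto simp: slit_plane_iff)
qed

text \<open>Keeps Euler's kernel off the branch cut of \<open>powr\<close>: a value on it would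
  force \<open>z * s\<close> to be real and at least 1, hence \<open>z\<close> onto the
  slit.\<close>

lemma one_minus_mult_notin_nonpos_Reals:
  assumes "z \<in> slit_plane" "0 \<le> s" "s \<le> 1"
  shows "1 - z * of_real s \<notin> \<real>\<^sub>\<le>\<^sub>0"
proof
  assume "1 - z * of_real s \<in> \<real>\<^sub>\<le>\<^sub>0"
  hence "Re z * s \<ge> 1" "Im z * s = 0" by (auto simp: complex_nonpos_Reals_iff)
  moreover from this have "s > 0" using assms by (cases "s = 0") auto
  moreover from calculation have "Re z > 0" using zero_less_mult_pos2[of "Re z" s] by linarith
  moreover from calculation have "Re z * s \<le> Re z"
    using assms by (intro mult_left_le) auto
  ultimately have "Re z \<ge> 1" "Im z = 0" by auto
  thus False using assms by (auto simp: slit_plane_iff)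
qed

text \<open>Euler's integral before division by \<open>Beta b d\<close>; \<open>d\<close> stands for
  \<open>c - b\<close>, so that convergence reads \<open>Re b > 0\<close> and
  \<open>Re d > 0\<close>.\<close>

definition euler_integral :: "complex \<Rightarrow> complex \<Rightarrow> complex \<Rightarrow> complex \<Rightarrow> complex" where
  "euler_integral a b d z = (LINT s:{0<..<1}|lborel.
     of_real s powr (b - 1) * of_real (1 - s) powr (d - 1) * (1 - z * of_real s) powr (-a))"

text \<open>Joint continuity up to the endpoints of \<open>{0..1}\<close> is what gives, by
  compactness, bounds uniform in both variables.\<close>

lemma continuous_on_euler_kernel:
  "continuous_on (slit_plane \<times> {0..1}) (\<lambda>(z, s). (1 - z * of_real s) powr (-a))"
proof -
  have "continuous_on (slit_plane \<times> {0..1}) (\<lambda>x. (1 - fst x * of_real (snd x)) powr (-a))"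
  proof (rule continuous_on_powr_complex)
    show "slit_plane \<times> {0..1} \<subseteq> 
       {x. 0 \<le> Re (1 - fst x * complex_of_real (snd x)) \<or> Im (1 - fst x * complex_of_real (snd x)) \<noteq> 0}"
      using one_minus_mult_notin_nonpos_Reals by (fastforce simp: complex_nonpos_Reals_iff)
    show "0 < Re (- a)" if "x \<in> slit_plane \<times> {0..1}" "1 - fst x * complex_of_real (snd x) = 0" for x
      using one_minus_mult_notin_nonpos_Reals[of "fst x" "snd x"] that by auto
  qed (intro continuous_intros)+
  thus ?thesis by (simp add: case_prod_unfold)
qed

lemma continuous_on_euler_kernel_section:
  assumes "z \<in> slit_plane"
  shows "continuous_on {0..1} (\<lambda>s. (1 - z * of_real s) powr (-a))"
proof -
  have "continuous_on {0..1} ((\<lambda>(z, s). (1 - z * of_real s) powr (-a)) \<circ> (\<lambda>s. (z, s)))"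
    using assms by (intro continuous_on_compose continuous_intros
      continuous_on_subset[OF continuous_on_euler_kernel]) auto
  thus ?thesis by (simp add: o_def)
qed

lemma euler_kernel_bounded:
  assumes "compact K" "K \<subseteq> slit_plane"
  shows "\<exists>M>0. \<forall>z\<in>K. \<forall>s\<in>{0..1}. norm ((1 - z * of_real s) powr (-a)) \<le> M"
proof -
  have "compact ((\<lambda>(z, s). (1 - z * of_real s) powr (-a)) ` (K \<times> {0..1::real}))"
    using assms by (intro compact_continuous_image compact_Times
        continuous_on_subset[OF continuous_on_euler_kernel]) auto
  hence "bounded ((\<lambda>(z, s). (1 - z * of_real s) powr (-a)) ` (K \<times> {0..1::real}))"
    by (rule compact_imp_bounded)
  thus ?thesis unfolding bounded_pos by fastforce
qed

lemma set_integrable_euler: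
  assumes "Re b > 0" "Re d > 0" "z \<in> slit_plane"
  shows "set_integrable lborel {0<..<1} (\<lambda>s.
     of_real s powr (b - 1) * of_real (1 - s) powr (d - 1) * (1 - z * of_real s) powr (-a))"
proof -
  obtain M where M: "M > 0" "\<And>s. s \<in> {0..1} \<Longrightarrow> norm ((1 - z * of_real s) powr (-a)) \<le> M"
    using euler_kernel_bounded[of "{z}" a] assms(3) by auto
  show ?thesis
  proof (rule set_integrable_continuous_bound)
    show "set_integrable lborel {0<..<1} (\<lambda>s. s powr (Re b - 1) * (1 - s) powr (Re d - 1) * M)"
      using set_integrable_Beta[of "Re b" "Re d"] assms M by simp
    show "continuous_on {0<..<1} (\<lambda>s. of_real s powr (b - 1) * of_real (1 - s) powr (d - 1) *
        (1 - z * of_real s) powr (-a))"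
      by (intro continuous_intros continuous_on_of_real_powr
           continuous_on_subset[OF continuous_on_euler_kernel_section[OF assms(3)]]) auto
    show "norm (of_real s powr (b - 1) * of_real (1 - s) powr (d - 1) * (1 - z * of_real s) powr (-a))
      \<le> s powr (Re b - 1) * (1 - s) powr (Re d - 1) * M" if "s \<in> {0<..<1}" for s
    proof -
      have "norm ((1 - z * of_real s) powr (-a)) \<le> M" using M(2)[of s] that by auto
      thus ?thesis using that
        by (auto simp: norm_mult norm_of_real_powr simp del: of_real_diff intro!: mult_left_mono)
    qed
  qed auto
qed

lemma holomorphic_on_euler_integral:
  assumes "Re b > 0" "Re d > 0"
  shows "euler_integral a b d holomorphic_on slit_plane"
  unfolding euler_integral_def[abs_def] set_lebesgue_integral_def
proof (rule holomorphic_on_dominated_integral[OF open_slit_plane])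
  let ?g = "\<lambda>z s. indicator {0<..<1} s *\<^sub>R (of_real s powr (b - 1) * of_real (1 - s) powr (d - 1) *
      (1 - z * of_real s) powr (-a)) :: complex"
  show "?g z \<in> borel_measurable lborel" if "z \<in> slit_plane" for z
    using set_integrable_euler[OF assms that]
    by (auto simp: set_integrable_def dest: borel_measurable_integrable)
  show "(\<lambda>z. ?g z s) holomorphic_on slit_plane" for s :: real
  proof (cases "s \<in> {0<..<1}")
    case True
    thus ?thesis using one_minus_mult_notin_nonpos_Reals[of _ s] by (auto intro!: holomorphic_intros)
  qed auto
  fix z0 assume "z0 \<in> slit_plane"
  then obtain r where r: "r > 0" "cball z0 r \<subseteq> slit_plane"
    using open_slit_plane open_contains_cball by blast
  obtain M where M: "M > 0"
    "\<And>z s. z \<in> cball z0 r \<Longrightarrow> s \<in> {0..1} \<Longrightarrow> norm ((1 - z * of_real s) powr (-a)) \<le> M"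
    using euler_kernel_bounded[OF compact_cball r(2), of a] by blast
  let ?h = "\<lambda>s. indicator {0<..<1} s *\<^sub>R (s powr (Re b - 1) * (1 - s) powr (Re d - 1) * M)"
  have "set_integrable lborel {0<..<1} (\<lambda>s. s powr (Re b - 1) * (1 - s) powr (Re d - 1) * M)"
    using set_integrable_Beta[of "Re b" "Re d"] assms M by simp
  hence "integrable lborel ?h" by (simp add: set_integrable_def)
  moreover have "norm (?g z s) \<le> ?h s" if "z \<in> ball z0 r" for z s
  proof (cases "s \<in> {0<..<1}")
    case True
    have "norm ((1 - z * of_real s) powr (-a)) \<le> M" using M(2)[of z s] that True by auto
    thus ?thesis using True
      by (auto simp: norm_mult norm_of_real_powr simp del: of_real_diff intro!: mult_left_mono)
  qed auto
  ultimately show "\<exists>r>0. \<exists>h. integrable lborel h \<and>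
      (\<forall>z\<in>ball z0 r \<inter> slit_plane. \<forall>s\<in>space lborel. norm (?g z s) \<le> h s)"
    using r by (intro exI[of _ r] exI[of _ ?h] conjI ballI) auto
qed

text \<open>The moments of the Beta density: they supply the factor \<open>(b)_k / (b + d)_k\<close>
  when the binomial series is integrated term by term.\<close>

lemma Beta_add_of_nat:
  fixes b d :: complex
  assumes "b \<notin> \<int>\<^sub>\<le>\<^sub>0" "b + d \<notin> \<int>\<^sub>\<le>\<^sub>0"
  shows "Beta (b + of_nat k) d = Beta b d * pochhammer b k / pochhammer (b + d) k"
proof -
  have nz: "Gamma b \<noteq> 0" "Gamma (b + d) \<noteq> 0" using assms by (auto simp: Gamma_eq_zero_iff)
  have "b + of_nat k + d = b + d + of_nat k" by simp
  thus ?thesis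
    using nz by (simp add: Beta_def pochhammer_Gamma[OF assms(1)] pochhammer_Gamma[OF assms(2)] add_ac)
qed

text \<open>Expand the kernel by the binomial series and integrate termwise. Since
  \<open>s ^ k \<le> 1\<close>, the terms are dominated by an absolutely convergent series times the
  Beta density.\<close>

lemma euler_integral_eq_series:
  assumes b: "Re b > 0" and d: "Re d > 0" and z: "norm z < 1"
  shows "euler_integral a b d z = Beta b d * hyp2F1_series a b (b + d) z"
proof -
  let ?w = "\<lambda>s. complex_of_real s powr (b - 1) * of_real (1 - s) powr (d - 1)"
  define f where "f k s = indicator {0<..<1} s *\<^sub>R (?w s * (pochhammer a k / fact k * (z * of_real s) ^ k))"
    for k s
  have f_eq: "f k s = pochhammer a k / fact k * z ^ k * (indicator {0<..<1} s *\<^sub>R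
      (of_real s powr (b + of_nat k - 1) * of_real (1 - s) powr (d - 1)))" for k s
  proof (cases "s \<in> {0<..<1}")
    case True
    have "complex_of_real s powr (b + of_nat k - 1) = of_real s powr (b - 1 + of_nat k)" 
      by (simp add: algebra_simps)
    also have "\<dots> = of_real s powr (b - 1) * of_real s ^ k"
      using True by (subst powr_add) simp
    finally show ?thesis using True by (simp add: f_def power_mult_distrib)
  qed (simp add: f_def)
  have Bk: "Re (b + of_nat k) > 0" for k using b by simp
  have int_f: "integrable lborel (f k)" for k
    unfolding f_eq using set_integrable_Beta_complex[OF Bk d, of k]
    unfolding set_integrable_def by (rule integrable_mult_right)
  have sumf: "f' sums (indicator {0<..<1} s *\<^sub>R (?w s * (1 - z * of_real s) powr (-a)))" 
    if "f' = (\<lambda>k. f k s)" for s f'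
  proof (cases "s \<in> {0<..<1}")
    case True
    have "norm (z * of_real s) < 1" 
      using True z mult_le_one[of "norm z" s] 
      by (simp add: norm_mult) (smt (verit) mult_left_le norm_ge_zero)
    from sums_scaleR_right[OF sums_mult[OF binomial_series_complex[OF this, of a], of "?w s"],
        of "indicator {0<..<1} s"]
    show ?thesis by (simp only: f_def that)
  qed (simp add: f_def that)
  let ?N = "\<lambda>k. norm (pochhammer a k / fact k * z ^ k)"
  \<comment> \<open>The binomial series is the Gauss series with \<open>b = c = 1\<close>.\<close>
  have "summable (\<lambda>k. norm (hyp2F1_coeff a 1 1 k * z ^ k))"
    by (rule summable_norm_hyp2F1) (use z in \<open>auto intro: Re_pos_imp_notin_nonpos_Ints\<close>)
  hence N: "summable ?N" 
    by (simp add: hyp2F1_coeff_def pochhammer_fact[symmetric])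
  have f_le: "norm (f k s) \<le> ?N k * norm (indicator {0<..<1} s *\<^sub>R ?w s)" for k s
  proof (cases "s \<in> {0<..<1}")
    case True
    have "norm (f k s) = ?N k * norm (?w s) * s ^ k"
      using True by (simp add: f_def norm_mult norm_power norm_divide power_mult_distrib)
    also have "\<dots> \<le> ?N k * norm (?w s) * 1"
      using True by (intro mult_left_mono power_le_one) auto
    finally show ?thesis using True by simp
  qed (simp add: f_def)
  have w_int: "integrable lborel (\<lambda>s. indicator {0<..<1} s *\<^sub>R ?w s)"
    using set_integrable_Beta_complex[OF b d] by (simp add: set_integrable_def)
  have sumI: "summable (\<lambda>k. \<integral>s. norm (f k s) \<partial>lborel)"
  proof (rule summable_comparison_test')
    show "summable (\<lambda>k. ?N k * (\<integral>s. norm (indicator {0<..<1} s *\<^sub>R ?w s) \<partial>lborel))"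
      by (intro summable_mult2 N)
    fix k
    have "(\<integral>s. norm (f k s) \<partial>lborel) \<le> (\<integral>s. ?N k * norm (indicator {0<..<1} s *\<^sub>R ?w s) \<partial>lborel)"
      using int_f w_int f_le by (intro integral_mono integrable_norm integrable_mult_right) auto
    thus "norm (\<integral>s. norm (f k s) \<partial>lborel) \<le> ?N k * (\<integral>s. norm (indicator {0<..<1} s *\<^sub>R ?w s) \<partial>lborel)"
      by simp
  qed
  have "(\<lambda>k. integral\<^sup>L lborel (f k)) sums (\<integral>s. (\<Sum>k. f k s) \<partial>lborel)"
  proof (rule sums_integral[OF int_f _ sumI], rule AE_I2)
    fix s :: real
    show "summable (\<lambda>k. norm (f k s))"
      by (rule summable_comparison_test'[OF summable_mult2[OF N]]) (use f_le in auto)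
  qed
  also have "(\<integral>s. (\<Sum>k. f k s) \<partial>lborel) = euler_integral a b d z"
    unfolding euler_integral_def set_lebesgue_integral_def
    by (intro Bochner_Integration.integral_cong refl sums_unique[symmetric] sumf)
  also have "(\<lambda>k. integral\<^sup>L lborel (f k)) = (\<lambda>k. Beta b d * (hyp2F1_coeff a b (b + d) k * z ^ k))"
  proof
    fix k
    have "integral\<^sup>L lborel (f k) = pochhammer a k / fact k * z ^ k * Beta (b + of_nat k) d"
      unfolding f_eq Beta_integral_complex[OF Bk d, of k, symmetric] set_lebesgue_integral_def
      by (rule integral_mult_right_zero)
    also have "Beta (b + of_nat k) d = Beta b d * pochhammer b k / pochhammer (b + d) k"
      by (intro Beta_add_of_nat Re_pos_imp_notin_nonpos_Ints) (use b d in simp_all)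
    finally show "integral\<^sup>L lborel (f k) = Beta b d * (hyp2F1_coeff a b (b + d) k * z ^ k)"
      by (simp add: hyp2F1_coeff_def mult_ac)
  qed
  finally have "(\<lambda>k. Beta b d * (hyp2F1_coeff a b (b + d) k * z ^ k)) sums euler_integral a b d z" .
  moreover have "(\<lambda>k. Beta b d * (hyp2F1_coeff a b (b + d) k * z ^ k)) sums
      (Beta b d * hyp2F1_series a b (b + d) z)"
    by (intro sums_mult sums_hyp2F1_series Re_pos_imp_notin_nonpos_Ints) (use b d z in simp_all)
  ultimately show ?thesis by (rule sums_unique2)
qed

subsection \<open>Contiguity and analytic continuation\<close>

lemma notin_nonpos_Ints_add_one: "c \<notin> \<int>\<^sub>\<le>\<^sub>0 \<Longrightarrow> c + 1 \<notin> \<int>\<^sub>\<le>\<^sub>0" for c :: complex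
  using plus_one_in_nonpos_Ints_imp by blast

lemma hyp2F1_coeff_Suc:
  assumes "c \<notin> \<int>\<^sub>\<le>\<^sub>0"
  shows "of_nat (Suc k) * hyp2F1_coeff a b c (Suc k) = a * b / c * hyp2F1_coeff (a + 1) (b + 1) (c + 1) k"
proof -
  have "(1 + of_nat k :: complex) \<noteq> 0" by (metis of_nat_Suc of_nat_neq_0)
  moreover have "c \<noteq> 0" using assms by auto
  ultimately show ?thesis
    by (simp add: hyp2F1_coeff_def pochhammer_rec)
qed

lemma hyp2F1_series_has_field_derivative:
  assumes c: "c \<notin> \<int>\<^sub>\<le>\<^sub>0" and z: "norm z < 1"
  shows "(hyp2F1_series a b c has_field_derivative
           a * b / c * hyp2F1_series (a + 1) (b + 1) (c + 1) z) (at z)"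
proof -
  obtain r where r: "norm z < r" "r < 1" using z dense by blast
  hence r0: "r > 0" using norm_ge_zero[of z] by linarith
  have "((\<lambda>z. \<Sum>k. hyp2F1_coeff a b c k * z ^ k) has_field_derivative
          (\<Sum>k. diffs (hyp2F1_coeff a b c) k * z ^ k)) (at z)"
    by (rule termdiffs_strong[OF summable_hyp2F1[OF c], of "of_real r"]) (use r r0 in auto)
  also have "(\<Sum>k. diffs (hyp2F1_coeff a b c) k * z ^ k) =
      (\<Sum>k. a * b / c * (hyp2F1_coeff (a + 1) (b + 1) (c + 1) k * z ^ k))"
    unfolding diffs_def hyp2F1_coeff_Suc[OF c] by (simp add: mult.assoc)
  also have "\<dots> = a * b / c * hyp2F1_series (a + 1) (b + 1) (c + 1) z"
    by (intro sums_unique[symmetric] sums_mult sums_hyp2F1_series notin_nonpos_Ints_add_one c z)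
  finally show ?thesis by (simp add: hyp2F1_series_altdef[abs_def])
qed

text \<open>The last bracket is \<open>f'\<close> for \<open>f = F(a,b+1;c+1)\<close>, kept in
  hypergeometric form so that inductions can apply to it. Rearranged as
  \<open>c f + z f' - c F = z (a f + z f')\<close>, the relation becomes a two-term recurrence
  between coefficients.\<close>

lemma hyp2F1_series_contiguous:
  assumes c: "c \<notin> \<int>\<^sub>\<le>\<^sub>0" and z: "norm z < 1"
  shows "c * hyp2F1_series a b c z = (c - a * z) * hyp2F1_series a (b + 1) (c + 1) z +
           z * (1 - z) * (a * (b + 1) / (c + 1) * hyp2F1_series (a + 1) (b + 2) (c + 2) z)"
proof -
  have c1: "c + 1 \<notin> \<int>\<^sub>\<le>\<^sub>0" and c2: "c + 2 \<notin> \<int>\<^sub>\<le>\<^sub>0"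
    using notin_nonpos_Ints_add_one[OF c] notin_nonpos_Ints_add_one[of "c + 1"] by (auto simp: add_ac)
  define G where "G = hyp2F1_coeff a (b + 1) (c + 1)"
  define S where "S = hyp2F1_series a (b + 1) (c + 1) z"
  define S' where "S' = a * (b + 1) / (c + 1) * hyp2F1_series (a + 1) (b + 2) (c + 2) z"
  have S: "(\<lambda>k. G k * z ^ k) sums S"
    unfolding G_def S_def by (rule sums_hyp2F1_series[OF c1 z])
  have "(\<lambda>k. z * (a * (b + 1) / (c + 1) * (hyp2F1_coeff (a + 1) (b + 2) (c + 2) k * z ^ k))) sums (z * S')"
    unfolding S'_def by (intro sums_mult sums_hyp2F1_series c2 z)
  also have "(\<lambda>k. z * (a * (b + 1) / (c + 1) * (hyp2F1_coeff (a + 1) (b + 2) (c + 2) k * z ^ k))) =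
      (\<lambda>k. of_nat (Suc k) * G (Suc k) * z ^ Suc k)"
    unfolding G_def hyp2F1_coeff_Suc[OF c1] by (simp add: add.assoc mult_ac)
  \<comment> \<open>The series of \<open>z f'\<close> has no constant term, so the index shift
    leaves nothing behind.\<close>
  finally have zS': "(\<lambda>k. of_nat k * G k * z ^ k) sums (z * S')"
    by (subst (asm) sums_Suc_iff) simp
  have "(\<lambda>k. c * (G k * z ^ k) + of_nat k * G k * z ^ k - c * (hyp2F1_coeff a b c k * z ^ k)) sums
     (c * S + z * S' - c * hyp2F1_series a b c z)"
    by (intro sums_add sums_diff sums_mult S zS' sums_hyp2F1_series c z)
  moreover have "(\<lambda>k. c * (G k * z ^ k) + of_nat k * G k * z ^ k - c * (hyp2F1_coeff a b c k * z ^ k)) sums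
     (z * (a * S + z * S'))"
  proof -
    have step: "(c + of_nat (Suc k)) * G (Suc k) = c * hyp2F1_coeff a b c (Suc k) + (a + of_nat k) * G k" for k
    proof -
      have ne: "c \<noteq> 0" "pochhammer (c + 1) k \<noteq> 0" "c + 1 + of_nat k \<noteq> 0"
        using c c1 by (auto dest: pochhammer_eq_0_imp_nonpos_Int simp: add_eq_0_iff2)
      have "(1 + of_nat k :: complex) \<noteq> 0" by (metis of_nat_Suc of_nat_neq_0)
      have "(c + of_nat (Suc k)) * G (Suc k) =
        pochhammer a k * (a + of_nat k) * pochhammer (b + 1) k * (b + 1 + of_nat k) /
          (pochhammer (c + 1) k * fact (Suc k))"
        using ne(3) unfolding G_def hyp2F1_coeff_def pochhammer_Suc by (simp add: add_ac)
      \<comment> \<open>Split \<open>b + 1 + k\<close> as \<open>b + (k + 1)\<close>: the first part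
        completes \<open>(b)_(k+1)\<close>, the second cancels against the factorial and leaves
        \<open>G k\<close>.\<close>
      also have "\<dots> = pochhammer a k * (a + of_nat k) * (b * pochhammer (b + 1) k) / (pochhammer (c + 1) k * fact (Suc k))
        + (a + of_nat k) * G k"
        using \<open>1 + of_nat k \<noteq> 0\<close> ne(2) unfolding G_def hyp2F1_coeff_def by (simp add: divide_simps) (simp add: algebra_simps)
      also have "pochhammer a k * (a + of_nat k) * (b * pochhammer (b + 1) k) / (pochhammer (c + 1) k * fact (Suc k))
         = c * hyp2F1_coeff a b c (Suc k)"
        using ne(1) unfolding hyp2F1_coeff_def pochhammer_Suc[of a] pochhammer_rec[of b] pochhammer_rec[of c] by simp
      finally show ?thesis .
    qed
    have "(\<lambda>k. z * (a * (G k * z ^ k) + of_nat k * G k * z ^ k)) sums (z * (a * S + z * S'))"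
      by (intro sums_mult sums_add S zS')
    also have "(\<lambda>k. z * (a * (G k * z ^ k) + of_nat k * G k * z ^ k)) =
        (\<lambda>k. ((c + of_nat (Suc k)) * G (Suc k) - c * hyp2F1_coeff a b c (Suc k)) * z ^ Suc k)"
      unfolding step by (simp add: algebra_simps)
    also have "\<dots> = (\<lambda>k. c * (G (Suc k) * z ^ Suc k) + of_nat (Suc k) * G (Suc k) * z ^ Suc k -
         c * (hyp2F1_coeff a b c (Suc k) * z ^ Suc k))"
      by (simp add: algebra_simps)
    \<comment> \<open>At index 0 both coefficients are 1, so the constant term \<open>c - c\<close>
      vanishes.\<close>
    finally show ?thesis
      by (subst (asm) sums_Suc_iff) (simp add: G_def hyp2F1_coeff_def)
  qed
  ultimately have "c * S + z * S' - c * hyp2F1_series a b c z = z * (a * S + z * S')"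
    by (rule sums_unique2)
  hence "c * hyp2F1_series a b c z = (c - a * z) * S + z * (1 - z) * S'" by (simp add: algebra_simps)
  thus ?thesis unfolding S_def S'_def .
qed

lemma eq_on_slit_plane:
  assumes "f holomorphic_on slit_plane" "g holomorphic_on slit_plane"
    and "\<And>u. norm u < 1 \<Longrightarrow> f u = g u" and "z \<in> slit_plane"
  shows "f z = g z"
proof -
  have "f z - g z = 0"
  proof (rule analytic_continuation[where S = slit_plane and f = "\<lambda>z. f z - g z" and
              U = "ball 0 1" and \<xi> = 0])
    show "(\<lambda>z. f z - g z) holomorphic_on slit_plane" using assms by (intro holomorphic_intros)
    show "(0::complex) islimpt ball 0 1" by (intro interior_limit_point) simp
  qed (use assms open_slit_plane connected_slit_plane ball_subset_slit_plane in auto)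
  thus ?thesis by simp
qed

text \<open>The access route to the definite description: any concrete continuation computes it, by
  the identity theorem on the connected slit plane.\<close>

lemma hyp2F1_eqI:
  assumes "f holomorphic_on slit_plane" "\<And>u. norm u < 1 \<Longrightarrow> f u = hyp2F1_series a b c u"
    and "z \<in> slit_plane"
  shows "hyp2F1 a b c z = f z"
  unfolding hyp2F1_def
proof (rule the_equality)
  show "\<exists>g. g holomorphic_on slit_plane \<and> (\<forall>u. norm u < 1 \<longrightarrow> g u = hyp2F1_series a b c u) \<and> f z = g z"
    using assms by blast
  show "w = f z" if "\<exists>g. g holomorphic_on slit_plane \<and>
      (\<forall>u. norm u < 1 \<longrightarrow> g u = hyp2F1_series a b c u) \<and> w = g z" for w
    using that assms eq_on_slit_plane[of _ f z] by metis
qed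

lemma Beta_nonzero: "Re p > 0 \<Longrightarrow> Re q > 0 \<Longrightarrow> Beta p q \<noteq> 0"
  using Re_pos_imp_notin_nonpos_Ints[of p] Re_pos_imp_notin_nonpos_Ints[of q]
    Re_pos_imp_notin_nonpos_Ints[of "p + q"]
  by (auto simp: Beta_def Gamma_eq_zero_iff)

text \<open>Induction on an \<open>n\<close> with \<open>Re b > - n\<close>. Euler's integral is the
  base; in the step the contiguity relation, solved for \<open>F(a,b;c)\<close>, is read as a
  definition of the continuation, and \<open>c \<noteq> 0\<close> permits the division.\<close>

lemma hyp2F1_continuation_exists:
  assumes "c \<notin> \<int>\<^sub>\<le>\<^sub>0" "Re (c - b) > 0"
  shows "\<exists>f. f holomorphic_on slit_plane \<and> (\<forall>u. norm u < 1 \<longrightarrow> f u = hyp2F1_series a b c u)"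
proof -
  obtain n :: nat where "Re b > - real n"
    using reals_Archimedean2[of "- Re b"] by (auto simp: minus_less_iff)
  thus ?thesis using assms
  proof (induction n arbitrary: a b c)
    case 0
    have B: "Beta b (c - b) \<noteq> 0" using 0 by (intro Beta_nonzero) auto
    show ?case
    proof (intro exI conjI allI impI)
      show "(\<lambda>z. euler_integral a b (c - b) z / Beta b (c - b)) holomorphic_on slit_plane"
        using 0 B by (intro holomorphic_intros holomorphic_on_euler_integral) auto
      show "euler_integral a b (c - b) u / Beta b (c - b) = hyp2F1_series a b c u" if "norm u < 1" for u
        using euler_integral_eq_series[of b "c - b" u a] 0 B that by simp
    qed
  next
    case (Suc n)
    have c1: "c + 1 \<notin> \<int>\<^sub>\<le>\<^sub>0" and c2: "c + 2 \<notin> \<int>\<^sub>\<le>\<^sub>0" and c0: "c \<noteq> 0"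
      using Suc.prems notin_nonpos_Ints_add_one[of c] notin_nonpos_Ints_add_one[of "c + 1"]
      by (auto simp: add_ac)
    obtain f where f: "f holomorphic_on slit_plane"
      "\<And>u. norm u < 1 \<Longrightarrow> f u = hyp2F1_series a (b + 1) (c + 1) u"
      using Suc.IH[of "b + 1" "c + 1" a] Suc.prems c1 by auto
    \<comment> \<open>The derivative term is continued as a Gauss function in its own right, which
      is why \<open>a\<close> must be arbitrary in the induction.\<close>
    obtain g where g: "g holomorphic_on slit_plane"
      "\<And>u. norm u < 1 \<Longrightarrow> g u = hyp2F1_series (a + 1) (b + 2) (c + 2) u"
      using Suc.IH[of "b + 2" "c + 2" "a + 1"] Suc.prems c2 by auto
    show ?case
    proof (intro exI conjI allI impI)
      show "(\<lambda>z. ((c - a * z) * f z + z * (1 - z) * (a * (b + 1) / (c + 1) * g z)) / c) holomorphic_on slit_plane"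
        using c0 by (intro holomorphic_intros f g) auto
      show "((c - a * u) * f u + u * (1 - u) * (a * (b + 1) / (c + 1) * g u)) / c = hyp2F1_series a b c u"
        if u: "norm u < 1" for u
        using hyp2F1_series_contiguous[OF Suc.prems(2) u, of a b, symmetric] f(2)[OF u] g(2)[OF u] c0
        by simp
    qed
  qed
qed

lemma
  assumes "c \<notin> \<int>\<^sub>\<le>\<^sub>0" "Re (c - b) > 0"
  shows holomorphic_on_hyp2F1: "hyp2F1 a b c holomorphic_on slit_plane"
    and hyp2F1_eq_series: "norm u < 1 \<Longrightarrow> hyp2F1 a b c u = hyp2F1_series a b c u"
proof -
  obtain f where f: "f holomorphic_on slit_plane" "\<And>u. norm u < 1 \<Longrightarrow> f u = hyp2F1_series a b c u"
    using hyp2F1_continuation_exists[OF assms, of a] by blast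
  have eq: "hyp2F1 a b c z = f z" if "z \<in> slit_plane" for z
    by (rule hyp2F1_eqI[OF f that])
  show "hyp2F1 a b c holomorphic_on slit_plane"
    using f(1) eq by (metis holomorphic_cong)
  show "norm u < 1 \<Longrightarrow> hyp2F1 a b c u = hyp2F1_series a b c u"
    using eq[of u] f(2)[of u] ball_subset_slit_plane by auto
qed

lemma hyp2F1_eq_euler_integral:
  assumes "Re b > 0" "Re (c - b) > 0" "z \<in> slit_plane"
  shows "hyp2F1 a b c z = euler_integral a b (c - b) z / Beta b (c - b)"
proof (rule hyp2F1_eqI[OF _ _ assms(3)])
  have B: "Beta b (c - b) \<noteq> 0" using assms by (intro Beta_nonzero) auto
  show "(\<lambda>z. euler_integral a b (c - b) z / Beta b (c - b)) holomorphic_on slit_plane"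
    using assms B by (intro holomorphic_intros holomorphic_on_euler_integral) auto
  show "euler_integral a b (c - b) u / Beta b (c - b) = hyp2F1_series a b c u" if "norm u < 1" for u
    using euler_integral_eq_series[of b "c - b" u a] assms B that by simp
qed

text \<open>All three functions share the same \<open>c - b\<close>, so they are holomorphic on the
  slit plane together and the identity spreads from the disc.\<close>

lemma hyp2F1_contiguous:
  assumes c: "c \<notin> \<int>\<^sub>\<le>\<^sub>0" and d: "Re (c - b) > 0" and z: "z \<in> slit_plane"
  shows "c * hyp2F1 a b c z = (c - a * z) * hyp2F1 a (b + 1) (c + 1) z +
           z * (1 - z) * (a * (b + 1) / (c + 1) * hyp2F1 (a + 1) (b + 2) (c + 2) z)"
proof -
  have c1: "c + 1 \<notin> \<int>\<^sub>\<le>\<^sub>0" and c2: "c + 2 \<notin> \<int>\<^sub>\<le>\<^sub>0"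
    using notin_nonpos_Ints_add_one[OF c] notin_nonpos_Ints_add_one[of "c + 1"] by (auto simp: add_ac)
  have d1: "Re (c + 1 - (b + 1)) > 0" and d2: "Re (c + 2 - (b + 2)) > 0" using d by simp_all
  show ?thesis
  proof (rule eq_on_slit_plane[OF _ _ _ z])
    show "(\<lambda>z. c * hyp2F1 a b c z) holomorphic_on slit_plane"
      by (intro holomorphic_intros holomorphic_on_hyp2F1 c d)
    show "(\<lambda>z. (c - a * z) * hyp2F1 a (b + 1) (c + 1) z +
           z * (1 - z) * (a * (b + 1) / (c + 1) * hyp2F1 (a + 1) (b + 2) (c + 2) z)) holomorphic_on slit_plane"
      using c1 by (intro holomorphic_intros holomorphic_on_hyp2F1 c1 c2 d1 d2) auto
    fix u :: complex assume u: "norm u < 1"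
    show "c * hyp2F1 a b c u = (c - a * u) * hyp2F1 a (b + 1) (c + 1) u +
           u * (1 - u) * (a * (b + 1) / (c + 1) * hyp2F1 (a + 1) (b + 2) (c + 2) u)"
      unfolding hyp2F1_eq_series[OF c d u] hyp2F1_eq_series[OF c1 d1 u] hyp2F1_eq_series[OF c2 d2 u]
      by (rule hyp2F1_series_contiguous[OF c u])
  qed
qed

lemma hyp2F1_has_field_derivative:
  assumes c: "c \<notin> \<int>\<^sub>\<le>\<^sub>0" and d: "Re (c - b) > 0" and z: "z \<in> slit_plane"
  shows "(hyp2F1 a b c has_field_derivative
           a * b / c * hyp2F1 (a + 1) (b + 1) (c + 1) z) (at z)"
proof -
  have c1: "c + 1 \<notin> \<int>\<^sub>\<le>\<^sub>0" by (rule notin_nonpos_Ints_add_one[OF c])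
  have d1: "Re (c + 1 - (b + 1)) > 0" using d by simp
  note hol = holomorphic_on_hyp2F1[OF c d, of a]
  have "deriv (hyp2F1 a b c) z = a * b / c * hyp2F1 (a + 1) (b + 1) (c + 1) z"
  proof (rule eq_on_slit_plane[OF _ _ _ z])
    show "deriv (hyp2F1 a b c) holomorphic_on slit_plane"
      by (rule holomorphic_deriv[OF hol open_slit_plane])
    show "(\<lambda>z. a * b / c * hyp2F1 (a + 1) (b + 1) (c + 1) z) holomorphic_on slit_plane"
      by (intro holomorphic_on_mult holomorphic_on_const holomorphic_on_hyp2F1 c1 d1)
    fix u :: complex assume u: "norm u < 1"
    have "(hyp2F1 a b c has_field_derivative
           a * b / c * hyp2F1_series (a + 1) (b + 1) (c + 1) u) (at u)"
      by (rule has_field_derivative_transform_within_open[OF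
            hyp2F1_series_has_field_derivative[OF c u] open_ball, of 0 1])
         (use u hyp2F1_eq_series[OF c d] in auto)
    thus "deriv (hyp2F1 a b c) u = a * b / c * hyp2F1 (a + 1) (b + 1) (c + 1) u"
      unfolding hyp2F1_eq_series[OF c1 d1 u] by (rule DERIV_imp_deriv)
  qed
  with holomorphic_derivI[OF hol open_slit_plane z] show ?thesis by simp
qed

subsection \<open>Fractional integrals on the real line\<close>

lemma of_real_powr_mult_self:
  "t > 0 \<Longrightarrow> complex_of_real t powr p = of_real t * of_real t powr (p - 1)"
  by (simp add: powr_diff)

lemma one_minus_mult_pos:
  fixes s y :: real
  assumes "0 \<le> s" "s < 1" "y \<le> 1"
  shows "1 - s * y > 0"
  using mult_left_mono[OF assms(3,1)] assms(2) by linarith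

section \<open>The Moebius substitution on a real interval\<close>

text \<open>Substitution takes place in the completed Lebesgue measure with
  \<open>\<bar>h x\<bar>\<close>. Continuity of the transformed integrand makes it Borel measurable,
  which brings integrability back to \<open>lborel\<close>.\<close>

lemma lborel_integral_of_change_of_variables:
  fixes f :: "real \<Rightarrow> complex" and g h :: "real \<Rightarrow> real"
  assumes "open A" "\<And>x. x \<in> A \<Longrightarrow> (g has_field_derivative h x) (at x)" "inj_on g A"
    and "\<And>x. x \<in> A \<Longrightarrow> h x \<ge> 0"
    and "set_integrable lborel (g ` A) f" "continuous_on A (\<lambda>x. h x *\<^sub>R f (g x))"
  shows "set_integrable lborel A (\<lambda>x. h x *\<^sub>R f (g x))"
    and "(LINT x:A|lborel. h x *\<^sub>R f (g x)) = (LINT x:g ` A|lborel. f x)"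
proof -
  have A: "A \<in> sets lebesgue" using \<open>open A\<close> by auto
  have cong: "set_integrable lebesgue A (\<lambda>x. \<bar>h x\<bar> *\<^sub>R f (g x)) \<longleftrightarrow>
      set_integrable lebesgue A (\<lambda>x. h x *\<^sub>R f (g x))"
    by (rule set_integrable_cong) (use assms(4) in auto)
  have "f absolutely_integrable_on g ` A"
    using assms(5) integrable_completion[of "\<lambda>x. indicator (g ` A) x *\<^sub>R f x" lborel]
    by (auto simp: set_integrable_def dest: borel_measurable_integrable)
  hence *: "(\<lambda>x. \<bar>h x\<bar> *\<^sub>R f (g x)) absolutely_integrable_on A \<and>
      integral A (\<lambda>x. \<bar>h x\<bar> *\<^sub>R f (g x)) = integral (g ` A) f"
    by (subst has_absolute_integral_change_of_variables_real[OF A])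
       (use assms in \<open>auto intro: has_field_derivative_at_within\<close>)
  have meas: "(\<lambda>x. indicator A x *\<^sub>R (h x *\<^sub>R f (g x))) \<in> borel_measurable lborel"
    using borel_measurable_continuous_on_indicator[OF _ assms(6)] \<open>open A\<close> by auto
  show int: "set_integrable lborel A (\<lambda>x. h x *\<^sub>R f (g x))"
    using * cong integrable_completion[OF meas] by (simp add: set_integrable_def)
  have "(LINT x:A|lborel. h x *\<^sub>R f (g x)) = integral A (\<lambda>x. h x *\<^sub>R f (g x))"
    by (rule set_borel_integral_eq_integral(2)[OF int])
  also have "\<dots> = integral A (\<lambda>x. \<bar>h x\<bar> *\<^sub>R f (g x))"
    by (rule Henstock_Kurzweil_Integration.integral_cong) (use assms(4) in auto)
  also have "\<dots> = integral (g ` A) f" using * by simp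
  also have "\<dots> = (LINT x:g ` A|lborel. f x)"
    by (rule set_borel_integral_eq_integral(2)[OF assms(5), symmetric])
  finally show "(LINT x:A|lborel. h x *\<^sub>R f (g x)) = (LINT x:g ` A|lborel. f x)" .
qed

text \<open>The map \<open>g\<close> sends \<open>x\<close> to 0 and 1 to 1. It,
  \<open>1 - g\<close> and its derivative \<open>h\<close> are all products and quotients of the
  factors present, so the integrand is a constant multiple of a pulled-back Beta density. The case
  \<open>p = \<mu>\<close>, \<open>q = a - \<mu>\<close> is Euler's kernel against the fractional
  weight.\<close>

lemma
  fixes p q :: complex and x s :: real
  assumes p: "Re p > 0" and q: "Re q > 0" and x: "x < 1" and s: "0 \<le> s" "s < 1"
  shows set_integrable_Beta_mobius: "set_integrable lborel {x<..<1} (\<lambda>y.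
      of_real (1 - y) powr (q - 1) * of_real (y - x) powr (p - 1) * of_real (1 - s * y) powr (- (p + q)))"
    and Beta_mobius_integral: "(LINT y:{x<..<1}|lborel.
      of_real (1 - y) powr (q - 1) * of_real (y - x) powr (p - 1) * of_real (1 - s * y) powr (- (p + q)))
      = Beta p q * of_real (1 - x) powr (p + q - 1) * of_real (1 - s * x) powr (-q) * of_real (1 - s) powr (-p)"
proof -
  note pos = one_minus_mult_pos[OF s]
  define g where "g y = (1 - s) * (y - x) / ((1 - x) * (1 - s * y))" for y
  define h where "h y = (1 - s) * (1 - s * x) / ((1 - x) * (1 - s * y)\<^sup>2)" for y
  let ?f = "\<lambda>u. complex_of_real u powr (p - 1) * of_real (1 - u) powr (q - 1)"
  let ?I = "\<lambda>y. of_real (1 - y) powr (q - 1) * of_real (y - x) powr (p - 1) * complex_of_real (1 - s * y) powr (- (p + q))"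
  \<comment> \<open>All factors free of \<open>y\<close>. With every base positive, writing powers
    as exponentials reduces the comparison to a linear identity between real logarithms, without
    branch questions.\<close>
  define K where "K = exp (p * of_real (ln (1 - s)) + q * of_real (ln (1 - s * x)) - (p + q - 1) * of_real (ln (1 - x)))"
  have one_minus_g: "1 - g y = (1 - y) * (1 - s * x) / ((1 - x) * (1 - s * y))" if "y \<in> {x<..<1}" for y
  proof -
    have "1 - x \<noteq> 0" "1 - s * y \<noteq> 0" using x pos[of y] that by auto
    thus ?thesis unfolding g_def by (simp add: divide_simps) (simp add: algebra_simps)
  qed
  have eq: "h y *\<^sub>R ?f (g y) = K * ?I y" if y: "y \<in> {x<..<1}" for y
  proof -
    have P: "1 - s > 0" "1 - s * x > 0" "1 - x > 0" "1 - s * y > 0" "y - x > 0" "1 - y > 0"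
      using pos[of x] pos[of y] x s y by auto
    have g: "g y > 0" "1 - g y > 0" using P unfolding one_minus_g[OF y] by (simp_all add: g_def)
    have lg: "ln (g y) = ln (1 - s) + ln (y - x) - ln (1 - x) - ln (1 - s * y)"
      using P by (simp add: g_def ln_div ln_mult)
    have lg': "ln (1 - g y) = ln (1 - y) + ln (1 - s * x) - ln (1 - x) - ln (1 - s * y)"
      unfolding one_minus_g[OF y] using P by (simp add: ln_div ln_mult)
    have "h y > 0" using P by (simp add: h_def)
    have lh: "ln (h y) = ln (1 - s) + ln (1 - s * x) - ln (1 - x) - 2 * ln (1 - s * y)"
      using P by (simp add: h_def ln_div ln_mult power2_eq_square)
    have "complex_of_real (h y) = exp (of_real (ln (h y)))"
      using \<open>h y > 0\<close> by (metis exp_ln exp_of_real)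
    hence "h y *\<^sub>R ?f (g y) = exp (of_real (ln (h y)) + (p - 1) * of_real (ln (g y)) + (q - 1) * of_real (ln (1 - g y)))"
      unfolding of_real_powr_eq_exp[OF g(1)] of_real_powr_eq_exp[OF g(2)] scaleR_conv_of_real
      by (simp add: exp_add mult_ac)
    also have "\<dots> = exp ((p * of_real (ln (1 - s)) + q * of_real (ln (1 - s * x)) - (p + q - 1) * of_real (ln (1 - x))) + 
       ((q - 1) * of_real (ln (1 - y)) + (p - 1) * of_real (ln (y - x)) + - (p + q) * of_real (ln (1 - s * y))))"
      unfolding lg lg' lh by (rule arg_cong[of _ _ exp]) (simp add: algebra_simps)
    also have "\<dots> = K * ?I y"
      unfolding K_def of_real_powr_eq_exp[OF P(4)] of_real_powr_eq_exp[OF P(5)] of_real_powr_eq_exp[OF P(6)]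
      by (simp only: exp_add mult.assoc)
    finally show ?thesis .
  qed
  have im: "g ` {x<..<1} = {0<..<1}"
  proof safe
    fix y assume y: "y \<in> {x<..<1}"
    have P: "1 - s > 0" "1 - s * x > 0" "1 - x > 0" "1 - s * y > 0" "y - x > 0" "1 - y > 0"
      using pos[of x] pos[of y] x s y by auto
    have "g y > 0" "1 - g y > 0" using P unfolding one_minus_g[OF y] by (simp_all add: g_def)
    thus "g y \<in> {0<..<1}" by simp
  next
    fix u :: real assume u: "u \<in> {0<..<1}"
    \<comment> \<open>Denominator of the inverse map: \<open>g y = u\<close> is linear in
      \<open>y\<close>, and \<open>D\<close> is the coefficient of \<open>y\<close>.\<close>
    define D where "D = (1 - s) + s * u * (1 - x)"
    define y where "y = (u * (1 - x) + (1 - s) * x) / D"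
    have D: "D > 0" unfolding D_def using s u x by (intro add_pos_nonneg) auto
    have yx: "y - x = u * (1 - x) * (1 - s * x) / D"
      using D unfolding y_def by (simp add: divide_simps) (simp add: D_def algebra_simps)
    have y1: "1 - y = (1 - s) * (1 - x) * (1 - u) / D"
      using D unfolding y_def by (simp add: divide_simps) (simp add: D_def algebra_simps)
    have sy: "1 - s * y = (1 - s) * (1 - s * x) / D"
      using D unfolding y_def by (simp add: divide_simps) (simp add: D_def algebra_simps)
    have "y - x > 0" "1 - y > 0" unfolding yx y1 using D u x s pos[of x] by auto
    moreover have "g y = u" unfolding g_def yx sy using D x s pos[of x] by simp
    ultimately show "u \<in> g ` {x<..<1}" by force
  qed
  have inj: "inj_on g {x<..<1}"
  proof (rule inj_onI)
    fix y z assume yz: "y \<in> {x<..<1}" "z \<in> {x<..<1}" "g y = g z"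
    have P: "1 - s > 0" "1 - s * x > 0" "1 - x > 0" "1 - s * y > 0" "1 - s * z > 0"
      using pos[of x] pos[of y] pos[of z] x s yz by auto
    have "(y - x) / (1 - s * y) = (1 - x) / (1 - s) * g y" "(z - x) / (1 - s * z) = (1 - x) / (1 - s) * g z"
      using P by (simp_all add: g_def)
    hence "(y - x) / (1 - s * y) = (z - x) / (1 - s * z)" using yz(3) by simp
    hence "(y - x) * (1 - s * z) = (z - x) * (1 - s * y)"
      using P by (simp add: frac_eq_eq)
    hence "(y - z) * (1 - s * x) = 0" by (simp add: algebra_simps)
    thus "y = z" using P by simp
  qed
  have der: "(g has_field_derivative h y) (at y)" if "y \<in> {x<..<1}" for y
  proof -
    have P: "1 - s * y \<noteq> 0" "1 - x \<noteq> 0" using pos[of y] x that by auto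
    have "(g has_field_derivative ((1 - s) * ((1 - x) * (1 - s * y)) - (1 - s) * (y - x) * ((1 - x) * (- s))) / ((1 - x) * (1 - s * y) * ((1 - x) * (1 - s * y)))) (at y)"
      unfolding g_def[abs_def] using P by (auto intro!: derivative_eq_intros)
    also have "((1 - s) * ((1 - x) * (1 - s * y)) - (1 - s) * (y - x) * ((1 - x) * (- s))) / ((1 - x) * (1 - s * y) * ((1 - x) * (1 - s * y))) = h y"
      unfolding h_def using P by (simp add: divide_simps power2_eq_square) (simp add: algebra_simps)
    finally show ?thesis .
  qed
  have hpos: "h y \<ge> 0" if "y \<in> {x<..<1}" for y
    using pos[of x] s x that by (simp add: h_def)
  have cont: "continuous_on {x<..<1} (\<lambda>y. h y *\<^sub>R ?f (g y))"
  proof -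
    have "continuous_on {x<..<1} (\<lambda>y. K * ?I y)"
      by (intro continuous_intros continuous_on_of_real_powr) (use pos in auto)
    thus ?thesis by (rule continuous_on_eq) (use eq in auto)
  qed
  have fint: "set_integrable lborel (g ` {x<..<1}) ?f"
    unfolding im by (rule set_integrable_Beta_complex[OF p q])
  note sub = lborel_integral_of_change_of_variables[OF open_greaterThanLessThan der inj hpos fint cont]
  have iK: "set_integrable lborel {x<..<1} (\<lambda>y. K * ?I y)"
    using sub(1) eq by (subst set_integrable_cong[OF refl refl eq[symmetric]]) auto
  have K0: "K \<noteq> 0" by (simp add: K_def)
  show "set_integrable lborel {x<..<1} ?I"
    by (rule iffD1[OF set_integrable_mult_right_iff[OF K0] iK])
  have "K * (LINT y:{x<..<1}|lborel. ?I y) = (LINT y:{x<..<1}|lborel. K * ?I y)" by simp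
  also have "\<dots> = (LINT y:{x<..<1}|lborel. h y *\<^sub>R ?f (g y))"
    by (rule set_lebesgue_integral_cong) (use eq in auto)
  also have "\<dots> = (LINT u:{0<..<1}|lborel. ?f u)" using sub(2) by (simp only: im)
  also have "\<dots> = Beta p q" by (rule Beta_integral_complex[OF p q])
  finally have "(LINT y:{x<..<1}|lborel. ?I y) = Beta p q * inverse K" using K0 by (simp add: field_simps)
  also have "inverse K = of_real (1 - x) powr (p + q - 1) * of_real (1 - s * x) powr (-q) * of_real (1 - s) powr (-p)"
  proof -
    have P: "1 - s > 0" "1 - s * x > 0" "1 - x > 0" using pos[of x] x s by auto
    show ?thesis
      unfolding K_def of_real_powr_eq_exp[OF P(1)] of_real_powr_eq_exp[OF P(2)] of_real_powr_eq_exp[OF P(3)]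
        exp_minus[symmetric] exp_add[symmetric] by (rule arg_cong[of _ _ exp]) simp
  qed
  finally show "(LINT y:{x<..<1}|lborel. ?I y) = Beta p q * of_real (1 - x) powr (p + q - 1) * 
       of_real (1 - s * x) powr (-q) * of_real (1 - s) powr (-p)" by (simp only: mult.assoc)
qed

section \<open>Growth at 1 and integrability against the fractional weight\<close>

lemma of_real_in_slit_plane: "y < 1 \<Longrightarrow> complex_of_real y \<in> slit_plane"
  by (simp add: slit_plane_iff)

lemma continuous_on_hyp2F1_of_real:
  assumes "c \<notin> \<int>\<^sub>\<le>\<^sub>0" "Re (c - b) > 0" "A \<subseteq> {..<1}"
  shows "continuous_on A (\<lambda>y. hyp2F1 a b c (of_real y))"
proof -
  have "continuous_on slit_plane (hyp2F1 a b c)"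
    by (intro holomorphic_on_imp_continuous_on holomorphic_on_hyp2F1 assms)
  thus ?thesis
    by (rule continuous_on_compose2) (use assms(3) of_real_in_slit_plane in \<open>auto intro!: continuous_intros\<close>)
qed

text \<open>The series controls \<open>[0,1)\<close>; left of 0 the series may diverge, but
  \<open>{x..0}\<close> is compact and the continuation is continuous there.\<close>

lemma hyp2F1_bound_real:
  assumes c: "c \<notin> \<int>\<^sub>\<le>\<^sub>0" and d: "Re (c - b) > 0" and s: "s > 0" "Re (a + b - c) \<le> s"
  shows "\<exists>C>0. \<forall>y. x \<le> y \<and> y < 1 \<longrightarrow> norm (hyp2F1 a b c (of_real y)) \<le> C * (1 - y) powr (-s)"
proof -
  obtain C where C: "C > 0" "\<And>y. 0 \<le> y \<Longrightarrow> y < 1 \<Longrightarrow>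
      norm (hyp2F1_series a b c (of_real y)) \<le> C * (1 - y) powr (-s)"
    using hyp2F1_series_bound_real[OF c s] by blast
  have "compact ((\<lambda>y. hyp2F1 a b c (of_real y)) ` {x..0})"
    by (intro compact_continuous_image continuous_on_hyp2F1_of_real c d) auto
  then obtain M where M: "M > 0" "\<And>y. x \<le> y \<Longrightarrow> y \<le> 0 \<Longrightarrow> norm (hyp2F1 a b c (of_real y)) \<le> M"
    using compact_imp_bounded[of "(\<lambda>y. hyp2F1 a b c (of_real y)) ` {x..0}"] unfolding bounded_pos by force
  \<comment> \<open>For \<open>x \<le> 0\<close> the least value of \<open>(1 - y) powr (-s)\<close>
    on \<open>{x..0}\<close>; dividing by it turns the constant bound \<open>M\<close> into one of
    the required shape.\<close>
  define L where "L = (1 - min x 0) powr (-s)"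
  have L: "L > 0" by (simp add: L_def)
  have "norm (hyp2F1 a b c (of_real y)) \<le> max C (M / L) * (1 - y) powr (-s)" if y: "x \<le> y" "y < 1" for y
  proof (cases "y \<ge> 0")
    case True
    have "norm (hyp2F1 a b c (of_real y)) \<le> C * (1 - y) powr (-s)"
      using C(2)[OF True y(2)] hyp2F1_eq_series[OF c d, of "of_real y"] True y by simp
    also have "\<dots> \<le> max C (M / L) * (1 - y) powr (-s)" by (intro mult_right_mono) auto
    finally show ?thesis .
  next
    case False
    have "norm (hyp2F1 a b c (of_real y)) \<le> M" using M(2)[OF y(1)] False by simp
    also have "\<dots> = M / L * L" using L by simp
    also have "\<dots> \<le> M / L * (1 - y) powr (-s)"
      unfolding L_def using False y s M by (intro mult_left_mono powr_mono2') auto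
    also have "\<dots> \<le> max C (M / L) * (1 - y) powr (-s)" by (intro mult_right_mono) auto
    finally show ?thesis .
  qed
  thus ?thesis using C(1) by (intro exI[of _ "max C (M / L)"]) auto
qed

text \<open>
  \<open>a - \<mu>\<close> rather than an independent exponent, so that raising \<open>a\<close> by 1 multiplies the weight by \<open>1 - y\<close>.
\<close>

definition frac_weight :: "complex \<Rightarrow> complex \<Rightarrow> real \<Rightarrow> real \<Rightarrow> complex" where
  "frac_weight a \<mu> x y = of_real (1 - y) powr (a - \<mu> - 1) * of_real (y - x) powr (\<mu> - 1)"

lemma continuous_on_frac_weight: "continuous_on {x<..<1} (frac_weight a \<mu> x)"
  unfolding frac_weight_def[abs_def] by (intro continuous_intros continuous_on_of_real_powr) auto

lemma norm_frac_weight: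
  "y \<in> {x<..<1} \<Longrightarrow>
     norm (frac_weight a \<mu> x y) = (1 - y) powr (Re a - Re \<mu> - 1) * (y - x) powr (Re \<mu> - 1)"
  by (simp add: frac_weight_def norm_mult norm_of_real_powr del: of_real_diff)

text \<open>The case \<open>s = 0\<close> of the Moebius integral, where Euler's kernel is
  1.\<close>

lemma set_integrable_frac_weight:
  assumes "Re a > Re \<mu>" "Re \<mu> > 0" "x < 1"
  shows "set_integrable lborel {x<..<1} (frac_weight a \<mu> x)"
proof -
  have "set_integrable lborel {x<..<1} (\<lambda>y.
      of_real (1 - y) powr (a - \<mu> - 1) * of_real (y - x) powr (\<mu> - 1) * of_real (1 - 0 * y) powr (- (\<mu> + (a - \<mu>))))"
    by (rule set_integrable_Beta_mobius) (use assms in auto)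
  thus ?thesis by (simp add: frac_weight_def[abs_def])
qed

text \<open>The two hypotheses say that \<open>Re a - Re \<mu>\<close> exceeds 0 and
  \<open>Re (a + b - c)\<close>, so room remains for a positive growth exponent which the weight
  absorbs. Half of \<open>Re a - Re \<mu>\<close> in the witness secures positivity.\<close>

lemma exponent_exists:
  assumes "Re a > Re \<mu>" "Re (c - b) > Re \<mu>"
  obtains s where "s > 0" "Re (a + b - c) \<le> s" "s < Re a - Re \<mu>"
  by (rule that[of "max (Re (a + b - c)) ((Re a - Re \<mu>) / 2)"])
     (use assms in \<open>auto simp: less_max_iff_disj\<close>)

text \<open>Growth of order \<open>(1 - y) powr (-s)\<close> amounts to lowering \<open>a\<close> by
  \<open>s\<close> in the weight, which leaves its exponent at 1 above -1.\<close>

lemma set_integrable_frac_weight_hyp2F1: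
  assumes c: "c \<notin> \<int>\<^sub>\<le>\<^sub>0" and a: "Re a > Re \<mu>" and m: "Re \<mu> > 0"
    and d: "Re (c - b) > Re \<mu>" and x: "x < 1"
  shows "set_integrable lborel {x<..<1} (\<lambda>y. frac_weight a \<mu> x y * hyp2F1 a b c (of_real y))"
proof -
  have d0: "Re (c - b) > 0" using d m by simp
  obtain s where s: "s > 0" "Re (a + b - c) \<le> s" "s < Re a - Re \<mu>"
    using exponent_exists[OF a d] .
  obtain C where C: "C > 0" "\<And>y. x \<le> y \<Longrightarrow> y < 1 \<Longrightarrow> norm (hyp2F1 a b c (of_real y)) \<le> C * (1 - y) powr (-s)"
    using hyp2F1_bound_real[OF c d0 s(1,2)] by blast
  show ?thesis
  proof (rule set_integrable_continuous_bound)
    show "continuous_on {x<..<1} (\<lambda>y. frac_weight a \<mu> x y * hyp2F1 a b c (of_real y))"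
      by (intro continuous_intros continuous_on_frac_weight continuous_on_hyp2F1_of_real c d0) auto
    have "set_integrable lborel {x<..<1} (frac_weight (a - of_real s) \<mu> x)"
      by (rule set_integrable_frac_weight) (use s m x in auto)
    thus "set_integrable lborel {x<..<1} (\<lambda>y. C * norm (frac_weight (a - of_real s) \<mu> x y))"
      by (intro set_integrable_mult_right set_integrable_norm)
    fix y assume y: "y \<in> {x<..<1}"
    have "norm (frac_weight a \<mu> x y * hyp2F1 a b c (of_real y)) \<le>
        norm (frac_weight a \<mu> x y) * (C * (1 - y) powr (-s))"
      unfolding norm_mult using C(2)[of y] y by (intro mult_left_mono) auto
    also have "\<dots> = C * (((1 - y) powr (Re a - Re \<mu> - 1) * (1 - y) powr (-s)) * (y - x) powr (Re \<mu> - 1))"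
      using y by (simp add: norm_frac_weight)
    also have "(1 - y) powr (Re a - Re \<mu> - 1) * (1 - y) powr (-s) = (1 - y) powr (Re (a - of_real s) - Re \<mu> - 1)"
      using y by (simp flip: powr_add add: algebra_simps)
    finally show "norm (frac_weight a \<mu> x y * hyp2F1 a b c (of_real y)) \<le> C * norm (frac_weight (a - of_real s) \<mu> x y)"
      using y by (simp add: norm_frac_weight)
  qed auto
qed

lemma frac_weight_add_one:
  "y < 1 \<Longrightarrow> frac_weight (a + 1) \<mu> x y = of_real (1 - y) * frac_weight a \<mu> x y"
  using of_real_powr_mult_self[of "1 - y" "a - \<mu>"]
  by (simp add: frac_weight_def mult.assoc del: of_real_diff)

section \<open>Contiguity under the fractional integral\<close>

text \<open>Disposes of the boundary terms of the integration by parts.\<close>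

lemma tendsto_zero_of_weight_bound:
  fixes \<Phi> :: "real \<Rightarrow> complex"
  assumes x: "x < 1" and pq: "p > 0" "q > 0"
    and bd: "\<And>y. y \<in> {x<..<1} \<Longrightarrow> norm (\<Phi> y) \<le> C * ((y - x) powr p * (1 - y) powr q)"
  shows "(\<Phi> \<longlongrightarrow> 0) (at_right x)" and "(\<Phi> \<longlongrightarrow> 0) (at_left 1)"
proof -
  let ?h = "\<lambda>y. C * ((y - x) powr p * (1 - y) powr q)"
  have ev1: "eventually (\<lambda>y. y \<in> {x<..<1}) (at_right x)" and ev2: "eventually (\<lambda>y. y \<in> {x<..<1}) (at_left 1)"
    using x by (auto intro: eventually_at_rightI eventually_at_leftI)
  have lim: "(?h \<longlongrightarrow> C * (0 powr p * (1 - x) powr q)) (at_right x)"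
  proof (intro tendsto_intros tendsto_powr2)
    show "((\<lambda>y. y - x) \<longlongrightarrow> 0) (at_right x)" by (auto intro!: tendsto_eq_intros)
  qed (use x pq ev1 in \<open>auto elim: eventually_mono\<close>)
  have lim': "(?h \<longlongrightarrow> C * ((1 - x) powr p * 0 powr q)) (at_left 1)"
  proof (intro tendsto_intros tendsto_powr2)
    show "((\<lambda>y. 1 - y) \<longlongrightarrow> (0::real)) (at_left 1)" by (auto intro!: tendsto_eq_intros)
  qed (use x pq ev2 in \<open>auto elim: eventually_mono\<close>)
  show "(\<Phi> \<longlongrightarrow> 0) (at_right x)"
    by (rule Lim_null_comparison[OF eventually_mono[OF ev1 bd]]) (use lim pq in simp_all)
  show "(\<Phi> \<longlongrightarrow> 0) (at_left 1)"
    by (rule Lim_null_comparison[OF eventually_mono[OF ev2 bd]]) (use lim' pq in simp_all)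
qed

text \<open>The coefficients on the right are those of the contiguity relation for
  \<open>a - \<mu>\<close>, \<open>b\<close>, \<open>c - \<mu>\<close> at the point
  \<open>x\<close>, apart from a factor \<open>1 - x\<close> that the raised \<open>a\<close>
  supplies once the second integral is evaluated.\<close>

lemma frac_integral_contiguous:
  assumes c: "c \<notin> \<int>\<^sub>\<le>\<^sub>0" and a: "Re a > Re \<mu>" and m: "Re \<mu> > 0"
    and d: "Re (c - b) > Re \<mu>" and x: "x < 1"
  defines "\<kappa> \<equiv> a * (b + 1) / (c + 1)"
  shows "c * (LINT y:{x<..<1}|lborel. frac_weight a \<mu> x y * hyp2F1 a b c (of_real y)) =
     (c - \<mu> - (a - \<mu>) * of_real x) *
        (LINT y:{x<..<1}|lborel. frac_weight a \<mu> x y * hyp2F1 a (b + 1) (c + 1) (of_real y)) +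
     of_real x * \<kappa> *
        (LINT y:{x<..<1}|lborel. frac_weight (a + 1) \<mu> x y * hyp2F1 (a + 1) (b + 2) (c + 2) (of_real y))"
proof -
  have c1: "c + 1 \<notin> \<int>\<^sub>\<le>\<^sub>0" and c2: "c + 2 \<notin> \<int>\<^sub>\<le>\<^sub>0"
    using notin_nonpos_Ints_add_one[OF c] notin_nonpos_Ints_add_one[of "c + 1"] by (auto simp: add_ac)
  have d0: "Re (c - b) > 0" using d m by simp
  have d1: "Re (c + 1 - (b + 1)) > 0" and d2: "Re (c + 2 - (b + 2)) > 0" using d0 by simp_all
  let ?F = "\<lambda>y. hyp2F1 a b c (complex_of_real y)"
  let ?f = "\<lambda>y. hyp2F1 a (b + 1) (c + 1) (complex_of_real y)"
  let ?g = "\<lambda>y. hyp2F1 (a + 1) (b + 2) (c + 2) (complex_of_real y)"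
  let ?W = "frac_weight a \<mu> x" and ?V = "frac_weight (a + 1) \<mu> x"
  define \<Phi> where "\<Phi> w = (w - of_real x) powr \<mu> * (1 - w) powr (a - \<mu>) * hyp2F1 a (b + 1) (c + 1) w" for w
  \<comment> \<open>This is the derivative of \<open>\<Phi>\<close> along the reals. In
    \<open>c F - \<Phi>' / W\<close> the coefficient of \<open>f\<close> is
    \<open>c - a y - \<mu> (1 - y) + (a - \<mu>) (y - x)\<close>, in which \<open>y\<close> cancels,
    and that of \<open>f'\<close> is \<open>y (1 - y) - (y - x) (1 - y) = x (1 - y)\<close>, whose
    \<open>1 - y\<close> turns \<open>W\<close> into \<open>V\<close>.\<close>
  define D where "D y = c * (?W y * ?F y) - (c - \<mu> - (a - \<mu>) * of_real x) * (?W y * ?f y)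
      - of_real x * \<kappa> * (?V y * ?g y)" for y
  have iF: "set_integrable lborel {x<..<1} (\<lambda>y. ?W y * ?F y)"
    by (rule set_integrable_frac_weight_hyp2F1[OF c a m d x])
  have if': "set_integrable lborel {x<..<1} (\<lambda>y. ?W y * ?f y)"
    by (rule set_integrable_frac_weight_hyp2F1[OF c1 a m _ x]) (use d in simp)
  have ig: "set_integrable lborel {x<..<1} (\<lambda>y. ?V y * ?g y)"
    by (rule set_integrable_frac_weight_hyp2F1[OF c2 _ m _ x]) (use d a in simp_all)
  have iD: "set_integrable lborel {x<..<1} D"
    unfolding D_def by (intro set_integral_diff set_integrable_mult_right iF if' ig)
  have der: "((\<lambda>y. \<Phi> (of_real y)) has_vector_derivative D y) (at y)" if y: "y \<in> {x<..<1}" for y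
  proof (rule has_vector_derivative_real_field)
    have ys: "complex_of_real y \<in> slit_plane" using y by (simp add: of_real_in_slit_plane)
    let ?p = "complex_of_real (y - x)" and ?q = "complex_of_real (1 - y)"
    have nr: "?p \<notin> \<real>\<^sub>\<le>\<^sub>0" "?q \<notin> \<real>\<^sub>\<le>\<^sub>0" using y by (auto simp: complex_nonpos_Reals_iff simp del: of_real_diff)
    have d1': "((\<lambda>w. (w - of_real x) powr \<mu>) has_field_derivative \<mu> * ?p powr (\<mu> - 1)) (at (of_real y))"
      using nr(1) by (auto intro!: derivative_eq_intros)
    have d2': "((\<lambda>w. (1 - w) powr (a - \<mu>)) has_field_derivative - (a - \<mu>) * ?q powr (a - \<mu> - 1)) (at (of_real y))"
      using nr(2) by (auto intro!: derivative_eq_intros simp: algebra_simps)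
    have "a * (b + 1) / (c + 1) * hyp2F1 (a + 1) (b + 1 + 1) (c + 1 + 1) (of_real y) = \<kappa> * ?g y"
      by (simp add: \<kappa>_def add.assoc)
    hence d3': "(hyp2F1 a (b + 1) (c + 1) has_field_derivative \<kappa> * ?g y) (at (of_real y))"
      using hyp2F1_has_field_derivative[OF c1 d1 ys, of a] by simp
    have "(\<Phi> has_field_derivative
        (\<mu> * ?p powr (\<mu> - 1) * ?q powr (a - \<mu>) + (- (a - \<mu>) * ?q powr (a - \<mu> - 1)) * ?p powr \<mu>) * ?f y
        + \<kappa> * ?g y * (?p powr \<mu> * ?q powr (a - \<mu>))) (at (of_real y))"
      using DERIV_mult[OF DERIV_mult[OF d1' d2'] d3'] by (simp add: \<Phi>_def[abs_def] of_real_diff)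
    moreover have "(\<mu> * ?p powr (\<mu> - 1) * ?q powr (a - \<mu>) + (- (a - \<mu>) * ?q powr (a - \<mu> - 1)) * ?p powr \<mu>) * ?f y
        + \<kappa> * ?g y * (?p powr \<mu> * ?q powr (a - \<mu>)) = D y"
    proof -
      define P where "P = ?p powr (\<mu> - 1)"
      define Q where "Q = ?q powr (a - \<mu> - 1)"
      have e1: "?p powr \<mu> = ?p * P" unfolding P_def by (rule of_real_powr_mult_self) (use y in simp)
      have e2: "?q powr (a - \<mu>) = ?q * Q" unfolding Q_def by (rule of_real_powr_mult_self) (use y in simp)
      have W: "?W y = Q * P" by (simp only: frac_weight_def P_def Q_def)
      have V: "?V y = ?q * (Q * P)" using frac_weight_add_one[of y a \<mu> x] y W by simp
      have "c * (?W y * ?F y) = Q * P * (c * ?F y)" unfolding W by (simp only: mult_ac)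
      also have "c * ?F y = (c - a * of_real y) * ?f y + of_real y * (1 - of_real y) * (\<kappa> * ?g y)"
        unfolding \<kappa>_def by (rule hyp2F1_contiguous[OF c d0 ys])
      finally have cF: "c * (?W y * ?F y) = Q * P * ((c - a * of_real y) * ?f y + of_real y * (1 - of_real y) * (\<kappa> * ?g y))" .
      show ?thesis
        unfolding D_def cF unfolding W V e1 e2 unfolding P_def[symmetric] Q_def[symmetric]
        unfolding of_real_diff of_real_1 by (simp add: algebra_simps)
    qed
    ultimately show "(\<Phi> has_field_derivative D y) (at (of_real y))" by simp
  qed
  have contD: "continuous_on {x<..<1} D"
    unfolding D_def[abs_def]
    by (intro continuous_intros continuous_on_frac_weight continuous_on_hyp2F1_of_real c c1 c2 d0 d1 d2) auto
  obtain s where s: "s > 0" "Re (a + b - c) \<le> s" "s < Re a - Re \<mu>"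
    using exponent_exists[OF a d] .
  \<comment> \<open>Raising \<open>b\<close> and \<open>c\<close> together leaves the growth
    exponent unchanged, so the same \<open>s\<close> bounds \<open>f\<close> and
    \<open>\<Phi>\<close> keeps the positive exponent \<open>Re a - Re \<mu> - s\<close> at
    1.\<close>
  have "Re (a + (b + 1) - (c + 1)) \<le> s" using s(2) by simp
  from hyp2F1_bound_real[OF c1 d1 s(1) this] obtain C where
    C: "C > 0" "\<And>y. x \<le> y \<Longrightarrow> y < 1 \<Longrightarrow> norm (?f y) \<le> C * (1 - y) powr (-s)" by blast
  have bd: "norm (\<Phi> (of_real y)) \<le> C * ((y - x) powr Re \<mu> * (1 - y) powr (Re a - Re \<mu> - s))"
    if y: "y \<in> {x<..<1}" for y
  proof -
    have "norm (\<Phi> (of_real y)) = (y - x) powr Re \<mu> * (1 - y) powr (Re a - Re \<mu>) * norm (?f y)"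
      using y norm_of_real_powr[of "y - x" \<mu>] norm_of_real_powr[of "1 - y" "a - \<mu>"]
      by (simp add: \<Phi>_def norm_mult)
    also have "\<dots> \<le> (y - x) powr Re \<mu> * (1 - y) powr (Re a - Re \<mu>) * (C * (1 - y) powr (-s))"
      using C(2)[of y] y by (intro mult_left_mono) auto
    also have "\<dots> = C * ((y - x) powr Re \<mu> * ((1 - y) powr (Re a - Re \<mu>) * (1 - y) powr (-s)))"
      by (simp add: mult_ac)
    also have "(1 - y) powr (Re a - Re \<mu>) * (1 - y) powr (-s) = (1 - y) powr (Re a - Re \<mu> - s)"
      using y by (simp flip: powr_add)
    finally show ?thesis .
  qed
  have lims: "((\<lambda>y. \<Phi> (of_real y)) \<longlongrightarrow> 0) (at_right x)" "((\<lambda>y. \<Phi> (of_real y)) \<longlongrightarrow> 0) (at_left 1)"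
    by (rule tendsto_zero_of_weight_bound[OF x m _ bd]; use s in simp)+
  have "(LBINT y=ereal x..ereal 1. D y) = 0 - 0"
  proof (rule interval_integral_FTC_integrable)
    show "ereal x < ereal 1" using x by simp
    show "((\<lambda>y. \<Phi> (of_real y)) has_vector_derivative D y) (at y)" if "ereal x < ereal y" "ereal y < ereal 1" for y
      using der[of y] that by simp
    show "isCont D y" if "ereal x < ereal y" "ereal y < ereal 1" for y
      using contD that by (auto simp: continuous_on_eq_continuous_at)
    show "set_integrable lborel (einterval (ereal x) (ereal 1)) D" using iD by simp
    show "(((\<lambda>y. \<Phi> (of_real y)) \<circ> real_of_ereal) \<longlongrightarrow> 0) (at_right (ereal x))"
      using lims(1) unfolding ereal_tendsto_simps .
    show "(((\<lambda>y. \<Phi> (of_real y)) \<circ> real_of_ereal) \<longlongrightarrow> 0) (at_left (ereal 1))"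
      using lims(2) unfolding ereal_tendsto_simps .
  qed
  hence "(LINT y:{x<..<1}|lborel. D y) = 0"
    using x by (simp add: interval_lebesgue_integral_le_eq)
  moreover have "(LINT y:{x<..<1}|lborel. D y) = c * (LINT y:{x<..<1}|lborel. ?W y * ?F y)
     - (c - \<mu> - (a - \<mu>) * of_real x) * (LINT y:{x<..<1}|lborel. ?W y * ?f y)
     - of_real x * \<kappa> * (LINT y:{x<..<1}|lborel. ?V y * ?g y)"
    unfolding D_def using iF if' ig
    by (simp only: set_integral_diff set_integrable_mult_right set_integral_mult_right)
  ultimately show ?thesis by (simp add: algebra_simps)
qed

definition frac_const :: "complex \<Rightarrow> complex \<Rightarrow> complex \<Rightarrow> complex \<Rightarrow> complex" where
  "frac_const a b c \<mu> = Gamma (a - \<mu>) / Gamma a * (Gamma (c - b - \<mu>) / Gamma (c - b)) *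
     (Gamma c / Gamma (c - \<mu>))"

text \<open>Matches the left-hand sides \<open>c F\<close> and \<open>(c - \<mu>) F\<close> of the
  two contiguity relations; the factor in \<open>c - b\<close> is untouched.\<close>

lemma frac_const_shift1:
  assumes "c \<notin> \<int>\<^sub>\<le>\<^sub>0" "c - \<mu> \<notin> \<int>\<^sub>\<le>\<^sub>0"
  shows "(c - \<mu>) * frac_const a (b + 1) (c + 1) \<mu> = c * frac_const a b c \<mu>"
proof -
  have "Gamma (c + 1) = c * Gamma c" "Gamma (c + 1 - \<mu>) = (c - \<mu>) * Gamma (c - \<mu>)"
    using Gamma_plus1[OF assms(1)] Gamma_plus1[OF assms(2)] by (simp_all add: algebra_simps)
  moreover have "c - \<mu> \<noteq> 0" using assms by auto
  ultimately show ?thesis by (simp add: frac_const_def mult_ac)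
qed

text \<open>Converts the derivative coefficient of \<open>F(a,b+1;c+1)\<close> into that of
  \<open>F(a-\<mu>,b+1;c+1-\<mu>)\<close>, so that both terms of the relation carry one common
  constant.\<close>

lemma frac_const_shift2:
  assumes "c + 1 \<notin> \<int>\<^sub>\<le>\<^sub>0" "c + 1 - \<mu> \<notin> \<int>\<^sub>\<le>\<^sub>0" "a \<notin> \<int>\<^sub>\<le>\<^sub>0" "a - \<mu> \<notin> \<int>\<^sub>\<le>\<^sub>0"
  shows "a * (b + 1) / (c + 1) * frac_const (a + 1) (b + 2) (c + 2) \<mu> =
         (a - \<mu>) * (b + 1) / (c + 1 - \<mu>) * frac_const a (b + 1) (c + 1) \<mu>"
proof -
  have G: "Gamma (c + 2) = (c + 1) * Gamma (c + 1)" "Gamma (c + 2 - \<mu>) = (c + 1 - \<mu>) * Gamma (c + 1 - \<mu>)"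
    "Gamma (a + 1) = a * Gamma a" "Gamma (a + 1 - \<mu>) = (a - \<mu>) * Gamma (a - \<mu>)"
    using Gamma_plus1[OF assms(1)] Gamma_plus1[OF assms(2)] Gamma_plus1[OF assms(3)] Gamma_plus1[OF assms(4)]
    by (simp_all add: algebra_simps)
  have "c + 1 \<noteq> 0" "a \<noteq> 0" using assms by auto
  thus ?thesis by (simp add: frac_const_def G mult_ac)
qed

text \<open>Inserting the two known integrals leaves a common factor times the right-hand side of
  the contiguity relation at \<open>x\<close> for \<open>a - \<mu>\<close>, \<open>b\<close>,
  \<open>c - \<mu>\<close>.\<close>

lemma frac_integral_hyp2F1_step:
  assumes c: "c \<notin> \<int>\<^sub>\<le>\<^sub>0" and cm: "c - \<mu> \<notin> \<int>\<^sub>\<le>\<^sub>0" and a: "Re a > Re \<mu>" and m: "Re \<mu> > 0"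
    and d: "Re (c - b) > Re \<mu>" and x: "x < 1"
    and IH1: "(LINT y:{x<..<1}|lborel. frac_weight a \<mu> x y * hyp2F1 a (b + 1) (c + 1) (of_real y)) =
      Gamma \<mu> * frac_const a (b + 1) (c + 1) \<mu> * of_real (1 - x) powr (a - 1) *
      hyp2F1 (a - \<mu>) (b + 1) (c + 1 - \<mu>) (of_real x)"
    and IH2: "(LINT y:{x<..<1}|lborel. frac_weight (a + 1) \<mu> x y * hyp2F1 (a + 1) (b + 2) (c + 2) (of_real y)) =
      Gamma \<mu> * frac_const (a + 1) (b + 2) (c + 2) \<mu> * of_real (1 - x) powr (a + 1 - 1) *
      hyp2F1 (a + 1 - \<mu>) (b + 2) (c + 2 - \<mu>) (of_real x)"
  shows "(LINT y:{x<..<1}|lborel. frac_weight a \<mu> x y * hyp2F1 a b c (of_real y)) =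
      Gamma \<mu> * frac_const a b c \<mu> * of_real (1 - x) powr (a - 1) *
      hyp2F1 (a - \<mu>) b (c - \<mu>) (of_real x)"
proof -
  have c1: "c + 1 \<notin> \<int>\<^sub>\<le>\<^sub>0" and cm1: "c + 1 - \<mu> \<notin> \<int>\<^sub>\<le>\<^sub>0" and c0: "c \<noteq> 0"
    using notin_nonpos_Ints_add_one[OF c] notin_nonpos_Ints_add_one[OF cm] c by (auto simp: algebra_simps)
  have a0: "a \<notin> \<int>\<^sub>\<le>\<^sub>0" "a - \<mu> \<notin> \<int>\<^sub>\<le>\<^sub>0" using a m by (simp_all add: Re_pos_imp_notin_nonpos_Ints)
  let ?X = "complex_of_real x" and ?R = "complex_of_real (1 - x) powr (a - 1)"
  let ?G1 = "hyp2F1 (a - \<mu>) (b + 1) (c + 1 - \<mu>) ?X" and ?G2 = "hyp2F1 (a + 1 - \<mu>) (b + 2) (c + 2 - \<mu>) ?X"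
  let ?G = "hyp2F1 (a - \<mu>) b (c - \<mu>) ?X"
  define K where "K = frac_const a (b + 1) (c + 1) \<mu>"
  \<comment> \<open>The split-off factor \<open>1 - x\<close> completes the \<open>x (1 - x)\<close>
    in front of the derivative term.\<close>
  have R: "complex_of_real (1 - x) powr (a + 1 - 1) = (1 - ?X) * ?R"
    using of_real_powr_mult_self[of "1 - x" a] x by simp
  have cont: "(c - \<mu>) * ?G = (c - \<mu> - (a - \<mu>) * ?X) * ?G1 +
      ?X * (1 - ?X) * ((a - \<mu>) * (b + 1) / (c + 1 - \<mu>) * ?G2)"
    using hyp2F1_contiguous[OF cm _ of_real_in_slit_plane[OF x], of b "a - \<mu>"] d
    by (simp add: algebra_simps)
  have "c * (LINT y:{x<..<1}|lborel. frac_weight a \<mu> x y * hyp2F1 a b c (of_real y)) =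
     (c - \<mu> - (a - \<mu>) * ?X) * (Gamma \<mu> * K * ?R * ?G1) +
     ?X * (a * (b + 1) / (c + 1)) * (Gamma \<mu> * frac_const (a + 1) (b + 2) (c + 2) \<mu> * ((1 - ?X) * ?R) * ?G2)"
    using frac_integral_contiguous[OF c a m d x] unfolding IH1 IH2 K_def R .
  also have "\<dots> = (c - \<mu> - (a - \<mu>) * ?X) * (Gamma \<mu> * K * ?R * ?G1) +
     ?X * (a * (b + 1) / (c + 1) * frac_const (a + 1) (b + 2) (c + 2) \<mu>) * (Gamma \<mu> * ((1 - ?X) * ?R) * ?G2)"
    by (simp only: mult_ac)
  also have "a * (b + 1) / (c + 1) * frac_const (a + 1) (b + 2) (c + 2) \<mu> = (a - \<mu>) * (b + 1) / (c + 1 - \<mu>) * K"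
    unfolding K_def by (rule frac_const_shift2[OF c1 cm1 a0])
  also have "(c - \<mu> - (a - \<mu>) * ?X) * (Gamma \<mu> * K * ?R * ?G1) +
     ?X * ((a - \<mu>) * (b + 1) / (c + 1 - \<mu>) * K) * (Gamma \<mu> * ((1 - ?X) * ?R) * ?G2) =
     Gamma \<mu> * K * ?R * ((c - \<mu> - (a - \<mu>) * ?X) * ?G1 +
      ?X * (1 - ?X) * ((a - \<mu>) * (b + 1) / (c + 1 - \<mu>) * ?G2))"
    by (simp only: distrib_left mult_ac)
  also have "\<dots> = Gamma \<mu> * ((c - \<mu>) * K) * ?R * ?G" unfolding cont[symmetric] by (simp only: mult_ac)
  also have "(c - \<mu>) * K = c * frac_const a b c \<mu>"
    unfolding K_def by (rule frac_const_shift1[OF c cm])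
  finally show ?thesis using c0 by (simp add: mult_ac)
qed

section \<open>Interchange of integrals for \<open>Re b > 0\<close>, and the descent in
  \<open>b\<close>\<close>

text \<open>With positive bases the modulus is the same integrand with \<open>Re p\<close>,
  \<open>Re q\<close> for \<open>p\<close>, \<open>q\<close>, so the closed form applies again. It
  supplies the absolute integrability for Fubini's theorem.\<close>

lemma norm_Beta_mobius_integral:
  fixes p q :: complex and x s :: real
  assumes p: "Re p > 0" and q: "Re q > 0" and x: "x < 1" and s: "0 \<le> s" "s < 1"
  shows "(LINT y:{x<..<1}|lborel. norm (complex_of_real (1 - y) powr (q - 1) *
           of_real (y - x) powr (p - 1) * of_real (1 - s * y) powr (- (p + q)))) =
         norm (Beta (complex_of_real (Re p)) (of_real (Re q))) * (1 - x) powr (Re p + Re q - 1) *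
           ((1 - s * x) powr (- Re q) * (1 - s) powr (- Re p))"
proof -
  note pos = one_minus_mult_pos[OF s]
  let ?r = "\<lambda>y. norm (complex_of_real (1 - y) powr (q - 1) *
           of_real (y - x) powr (p - 1) * of_real (1 - s * y) powr (- (p + q)))"
  let ?p = "complex_of_real (Re p)" and ?q = "complex_of_real (Re q)"
  have "complex_of_real (LINT y:{x<..<1}|lborel. ?r y) = (LINT y:{x<..<1}|lborel. complex_of_real (?r y))"
    by (rule set_integral_complex_of_real[symmetric])
  also have "\<dots> = (LINT y:{x<..<1}|lborel. complex_of_real (1 - y) powr (?q - 1) *
           of_real (y - x) powr (?p - 1) * of_real (1 - s * y) powr (- (?p + ?q)))"
  proof (intro set_lebesgue_integral_cong allI impI)
    fix y assume y: "y \<in> {x<..<1}"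
    have "?r y = (1 - y) powr (Re q - 1) * (y - x) powr (Re p - 1) * (1 - s * y) powr (- (Re p + Re q))"
      using y pos[of y] by (simp add: norm_mult norm_of_real_powr del: of_real_diff)
    also have "complex_of_real \<dots> = complex_of_real (1 - y) powr (?q - 1) *
           of_real (y - x) powr (?p - 1) * of_real (1 - s * y) powr (- (?p + ?q))"
      using y pos[of y] powr_of_real[of "1 - y" "Re q - 1"] powr_of_real[of "y - x" "Re p - 1"]
        powr_of_real[of "1 - s * y" "- (Re p + Re q)"]
      by simp
    finally show "complex_of_real (?r y) = complex_of_real (1 - y) powr (?q - 1) *
           of_real (y - x) powr (?p - 1) * of_real (1 - s * y) powr (- (?p + ?q))" .
  qed auto
  also have "\<dots> = Beta ?p ?q * of_real (1 - x) powr (?p + ?q - 1) * of_real (1 - s * x) powr (-?q) *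
      of_real (1 - s) powr (-?p)"
    by (rule Beta_mobius_integral) (use p q x s in auto)
  finally have "norm (complex_of_real (LINT y:{x<..<1}|lborel. ?r y)) =
     norm (Beta ?p ?q) * (1 - x) powr (Re p + Re q - 1) * (1 - s * x) powr (- Re q) * (1 - s) powr (- Re p)"
    using x s pos[of x] by (simp add: norm_mult norm_of_real_powr del: of_real_diff of_real_mult)
  moreover have "(LINT y:{x<..<1}|lborel. ?r y) \<ge> 0"
    unfolding set_lebesgue_integral_def by (intro Bochner_Integration.integral_nonneg) auto
  ultimately show ?thesis by (simp add: mult.assoc)
qed

text \<open>Integrating over \<open>y\<close> first yields \<open>(1 - s) powr (- \<mu>)\<close> and
  \<open>(1 - s x) powr (- (a - \<mu>))\<close>, which shift Euler's integrand to the parameters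
  \<open>a - \<mu>\<close> and \<open>c - \<mu>\<close>; its convergence at \<open>s = 1\<close> is
  the condition \<open>Re (c - b) > Re \<mu>\<close>.\<close>

lemma frac_integral_hyp2F1_base:
  assumes b: "Re b > 0" and a: "Re a > Re \<mu>" and m: "Re \<mu> > 0"
    and d: "Re (c - b) > Re \<mu>" and x: "x < 1"
  shows "(LINT y:{x<..<1}|lborel. frac_weight a \<mu> x y * hyp2F1 a b c (of_real y)) =
      Gamma \<mu> * frac_const a b c \<mu> * of_real (1 - x) powr (a - 1) *
      hyp2F1 (a - \<mu>) b (c - \<mu>) (of_real x)"
proof -
  define e where "e = c - b"
  have e: "Re e > Re \<mu>" "Re e > 0" "Re (e - \<mu>) > 0" using d m by (auto simp: e_def)
  have pos: "1 - s * y > 0" if "0 < s" "s < 1" "y \<le> 1" for s y :: real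
    using one_minus_mult_pos[of s y] that by simp
  let ?w = "\<lambda>s. complex_of_real s powr (b - 1) * of_real (1 - s) powr (e - 1)"
  let ?I = "\<lambda>s y. frac_weight a \<mu> x y * complex_of_real (1 - s * y) powr (- a)"
  let ?J = "{0<..<1::real}" and ?K = "{x<..<1}"
  define h where "h s y = (indicator ?J s *\<^sub>R ?w s) * (indicator ?K y *\<^sub>R ?I s y)" for s y
  have swap: "1 - complex_of_real y * of_real s = of_real (1 - s * y)" for y s by (simp add: mult.commute)
  have I_int: "set_integrable lborel ?K (?I s)"
    and I_eq: "(LINT y:?K|lborel. ?I s y) = Beta \<mu> (a - \<mu>) * of_real (1 - x) powr (a - 1) *
        of_real (1 - s * x) powr (- (a - \<mu>)) * of_real (1 - s) powr (- \<mu>)" 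
    and I_norm: "(LINT y:?K|lborel. norm (?I s y)) =
        norm (Beta (complex_of_real (Re \<mu>)) (of_real (Re (a - \<mu>)))) * (1 - x) powr (Re \<mu> + Re (a - \<mu>) - 1) *
           ((1 - s * x) powr (- Re (a - \<mu>)) * (1 - s) powr (- Re \<mu>))" if "s \<in> ?J" for s
    using set_integrable_Beta_mobius[of \<mu> "a - \<mu>" x s] Beta_mobius_integral[of \<mu> "a - \<mu>" x s]
      norm_Beta_mobius_integral[of \<mu> "a - \<mu>" x s] a m x that
    by (simp_all add: frac_weight_def del: of_real_diff of_real_mult)
  have meas: "(\<lambda>(s, y). h s y) \<in> borel_measurable (lborel \<Otimes>\<^sub>M lborel)"
  proof -
    have "(\<lambda>z. indicator (?J \<times> ?K) z *\<^sub>R (?w (fst z) * ?I (fst z) (snd z))) \<in> borel_measurable borel"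
    proof (rule borel_measurable_continuous_on_indicator)
      show "?J \<times> ?K \<in> sets borel" by (intro borel_open open_Times) auto
      have posz: "0 < fst z" "0 < 1 - fst z" "0 < 1 - snd z" "0 < snd z - x" "0 < 1 - fst z * snd z"
        if "z \<in> ?J \<times> ?K" for z
        using that pos[of "fst z" "snd z"] by (simp_all add: mem_Times_iff)
      show "continuous_on (?J \<times> ?K) (\<lambda>z. ?w (fst z) * ?I (fst z) (snd z))"
        unfolding frac_weight_def
        by (intro continuous_on_mult continuous_on_of_real_powr continuous_on_diff continuous_on_const
              continuous_on_fst continuous_on_snd continuous_on_id posz)
    qed
    moreover have "(\<lambda>z. indicator (?J \<times> ?K) z *\<^sub>R (?w (fst z) * ?I (fst z) (snd z))) = (\<lambda>(s, y). h s y)"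
      by (auto simp: h_def fun_eq_iff indicator_def)
    ultimately show ?thesis by (simp add: lborel_prod)
  qed
  \<comment> \<open>The inner integral of moduli is a constant times the modulus of the shifted
    Euler integrand, whose integrability is already known.\<close>
  have int1: "integrable lborel (\<lambda>s. \<integral>y. norm (h s y) \<partial>lborel)"
  proof -
    define B where "B = norm (Beta (complex_of_real (Re \<mu>)) (of_real (Re (a - \<mu>)))) * (1 - x) powr (Re \<mu> + Re (a - \<mu>) - 1)"
    have "set_integrable lborel ?J (\<lambda>s. complex_of_real s powr (b - 1) * of_real (1 - s) powr (e - \<mu> - 1) *
        (1 - of_real x * of_real s) powr (- (a - \<mu>)))"
      by (rule set_integrable_euler[OF b e(3) of_real_in_slit_plane[OF x]])
    hence "integrable lborel (\<lambda>s. B * norm (indicator ?J s *\<^sub>R (complex_of_real s powr (b - 1) * of_real (1 - s) powr (e - \<mu> - 1) *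
        (1 - of_real x * of_real s) powr (- (a - \<mu>)))))"
      unfolding set_integrable_def by (intro integrable_mult_right integrable_norm)
    also have "(\<lambda>s. B * norm (indicator ?J s *\<^sub>R (complex_of_real s powr (b - 1) * of_real (1 - s) powr (e - \<mu> - 1) *
        (1 - of_real x * of_real s) powr (- (a - \<mu>))))) = (\<lambda>s. \<integral>y. norm (h s y) \<partial>lborel)"
    proof
      fix s :: real
      show "B * norm (indicator ?J s *\<^sub>R (complex_of_real s powr (b - 1) * of_real (1 - s) powr (e - \<mu> - 1) *
        (1 - of_real x * of_real s) powr (- (a - \<mu>)))) = (\<integral>y. norm (h s y) \<partial>lborel)"
      proof (cases "s \<in> ?J")
        case True
        have "(\<lambda>y. norm (h s y)) = (\<lambda>y. norm (?w s) * (indicator ?K y *\<^sub>R norm (?I s y)))"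
          using True by (simp add: h_def norm_mult fun_eq_iff)
        hence "(\<integral>y. norm (h s y) \<partial>lborel) = norm (?w s) * (LINT y:?K|lborel. norm (?I s y))"
          unfolding set_lebesgue_integral_def by (simp only: integral_mult_right_zero)
        also have "\<dots> = norm (?w s) * (B * ((1 - s * x) powr (- Re (a - \<mu>)) * (1 - s) powr (- Re \<mu>)))"
          unfolding I_norm[OF True] B_def ..
        also have "norm (?w s) = s powr (Re b - 1) * (1 - s) powr (Re e - 1)"
          using True by (simp add: norm_mult norm_of_real_powr del: of_real_diff)
        also have "s powr (Re b - 1) * (1 - s) powr (Re e - 1) * (B * ((1 - s * x) powr (- Re (a - \<mu>)) * (1 - s) powr (- Re \<mu>)))
          = B * (s powr (Re b - 1) * ((1 - s) powr (Re e - 1) * (1 - s) powr (- Re \<mu>)) * (1 - s * x) powr (- Re (a - \<mu>)))"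
          by (simp only: mult_ac)
        also have "(1 - s) powr (Re e - 1) * (1 - s) powr (- Re \<mu>) = (1 - s) powr (Re (e - \<mu> - 1))"
          using True by (simp flip: powr_add add: algebra_simps)
        also have "B * (s powr (Re b - 1) * (1 - s) powr (Re (e - \<mu> - 1)) * (1 - s * x) powr (- Re (a - \<mu>))) =
           B * norm (indicator ?J s *\<^sub>R (complex_of_real s powr (b - 1) * of_real (1 - s) powr (e - \<mu> - 1) *
            (1 - of_real x * of_real s) powr (- (a - \<mu>))))"
          using True pos[of s x] x unfolding swap
          by (simp add: norm_mult norm_of_real_powr del: of_real_diff of_real_mult)
        finally show ?thesis by simp
      qed (simp add: h_def)
    qed
    finally show ?thesis .
  qed
  have int2: "integrable lborel (h s)" for s
  proof (cases "s \<in> ?J")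
    case True
    thus ?thesis using I_int[OF True] unfolding h_def set_integrable_def by (intro integrable_mult_right)
  next
    case False
    hence "h s = (\<lambda>_. 0)" by (simp add: h_def fun_eq_iff)
    thus ?thesis by simp
  qed
  have prod_int: "integrable (lborel \<Otimes>\<^sub>M lborel) (\<lambda>(s, y). h s y)"
    by (rule lborel_pair.Fubini_integrable[OF meas]) (use int1 int2 in auto)
  have fubini: "(\<integral>y. (\<integral>s. h s y \<partial>lborel) \<partial>lborel) = (\<integral>s. (\<integral>y. h s y \<partial>lborel) \<partial>lborel)"
    by (rule lborel_pair.Fubini_integral[OF prod_int])
  have B0: "Beta b e \<noteq> 0" "Beta b (e - \<mu>) \<noteq> 0" using b e by (simp_all add: Beta_nonzero)
  have s_first: "(\<integral>s. h s y \<partial>lborel) = indicator ?K y *\<^sub>R (Beta b e * (frac_weight a \<mu> x y * hyp2F1 a b c (of_real y)))" for y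
  proof (cases "y \<in> ?K")
    case True
    have "(\<integral>s. h s y \<partial>lborel) = (\<integral>s. frac_weight a \<mu> x y * (indicator ?J s *\<^sub>R (?w s * (1 - of_real y * of_real s) powr (- a))) \<partial>lborel)"
      by (rule Bochner_Integration.integral_cong) (use True in \<open>auto simp: h_def mult_ac indicator_def\<close>)
    also have "\<dots> = frac_weight a \<mu> x y * euler_integral a b e (of_real y)"
      unfolding euler_integral_def set_lebesgue_integral_def by (rule integral_mult_right_zero)
    also have "euler_integral a b e (of_real y) = Beta b e * hyp2F1 a b c (of_real y)"
      using hyp2F1_eq_euler_integral[of b c "of_real y" a] b e True B0 of_real_in_slit_plane[of y]
      unfolding e_def[symmetric] by simp
    finally show ?thesis using True by simp
  qed (simp add: h_def)
  have y_first: "(\<integral>y. h s y \<partial>lborel) = Beta \<mu> (a - \<mu>) * of_real (1 - x) powr (a - 1) *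
     (indicator ?J s *\<^sub>R (of_real s powr (b - 1) * of_real (1 - s) powr (e - \<mu> - 1) * (1 - of_real x * of_real s) powr (- (a - \<mu>))))" for s
  proof (cases "s \<in> ?J")
    case True
    have "(\<integral>y. h s y \<partial>lborel) = (indicator ?J s *\<^sub>R ?w s) * (LINT y:?K|lborel. ?I s y)"
      unfolding h_def set_lebesgue_integral_def by (rule integral_mult_right_zero)
    also have "\<dots> = Beta \<mu> (a - \<mu>) * of_real (1 - x) powr (a - 1) * 
       (of_real s powr (b - 1) * (of_real (1 - s) powr (e - 1) * of_real (1 - s) powr (- \<mu>)) * of_real (1 - s * x) powr (- (a - \<mu>)))"
      unfolding I_eq[OF True] using True by (simp add: mult_ac del: of_real_diff of_real_mult)
    also have "complex_of_real (1 - s) powr (e - 1) * of_real (1 - s) powr (- \<mu>) = of_real (1 - s) powr (e - \<mu> - 1)"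
      using True by (simp flip: powr_add add: algebra_simps)
    finally show ?thesis using True unfolding swap by simp
  qed (simp add: h_def)
  have "Beta b e * (LINT y:?K|lborel. frac_weight a \<mu> x y * hyp2F1 a b c (of_real y)) =
      (LINT y:?K|lborel. Beta b e * (frac_weight a \<mu> x y * hyp2F1 a b c (of_real y)))"
    by (rule set_integral_mult_right[symmetric])
  also have "\<dots> = Beta \<mu> (a - \<mu>) * of_real (1 - x) powr (a - 1) * euler_integral (a - \<mu>) b (e - \<mu>) (of_real x)"
    using fubini unfolding s_first y_first set_lebesgue_integral_def euler_integral_def integral_mult_right_zero .
  also have "euler_integral (a - \<mu>) b (e - \<mu>) (of_real x) = Beta b (e - \<mu>) * hyp2F1 (a - \<mu>) b (c - \<mu>) (of_real x)"
  proof -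
    have eq: "c - \<mu> - b = e - \<mu>" by (simp add: e_def)
    have "hyp2F1 (a - \<mu>) b (c - \<mu>) (of_real x) =
        euler_integral (a - \<mu>) b (c - \<mu> - b) (of_real x) / Beta b (c - \<mu> - b)"
      by (rule hyp2F1_eq_euler_integral[OF b _ of_real_in_slit_plane[OF x]]) (use d in simp)
    thus ?thesis using B0 unfolding eq by simp
  qed
  finally have "(LINT y:?K|lborel. frac_weight a \<mu> x y * hyp2F1 a b c (of_real y)) =
     (Beta \<mu> (a - \<mu>) * Beta b (e - \<mu>) / Beta b e) * of_real (1 - x) powr (a - 1) * hyp2F1 (a - \<mu>) b (c - \<mu>) (of_real x)"
    using B0 by (simp add: field_simps)
  \<comment> \<open>\<open>Gamma b\<close> cancels between the last two Beta values, while
    \<open>Gamma \<mu>\<close> survives from the first.\<close>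
  also have "Beta \<mu> (a - \<mu>) * Beta b (e - \<mu>) / Beta b e = Gamma \<mu> * frac_const a b c \<mu>"
  proof -
    have Gb: "Gamma b \<noteq> 0" using b Re_pos_imp_notin_nonpos_Ints[of b] by (simp add: Gamma_eq_zero_iff)
    have eqs: "b + e = c" "b + (e - \<mu>) = c - \<mu>" "c - b - \<mu> = e - \<mu>" "c - b = e" "\<mu> + (a - \<mu>) = a" by (auto simp: e_def)
    show ?thesis unfolding Beta_def frac_const_def eqs using Gb by (simp add: mult_ac)
  qed
  finally show ?thesis .
qed

text \<open>The same descent as for the continuation: both instances keep \<open>c - b\<close>, do
  not lower \<open>Re a\<close>, and move \<open>c\<close> and \<open>c - \<mu>\<close> upwards by
  integers, so all hypotheses persist.\<close>

lemma frac_integral_hyp2F1: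
  assumes "c \<notin> \<int>\<^sub>\<le>\<^sub>0" "c - \<mu> \<notin> \<int>\<^sub>\<le>\<^sub>0" "Re a > Re \<mu>" "Re \<mu> > 0" "Re (c - b) > Re \<mu>" "x < 1"
  shows "(LINT y:{x<..<1}|lborel. frac_weight a \<mu> x y * hyp2F1 a b c (of_real y)) =
      Gamma \<mu> * frac_const a b c \<mu> * of_real (1 - x) powr (a - 1) *
      hyp2F1 (a - \<mu>) b (c - \<mu>) (of_real x)"
proof -
  obtain n :: nat where "Re b > - real n"
    using reals_Archimedean2[of "- Re b"] by (auto simp: minus_less_iff)
  thus ?thesis using assms
  proof (induction n arbitrary: a b c)
    case 0
    thus ?case by (intro frac_integral_hyp2F1_base) simp_all
  next
    case (Suc n)
    have c1: "c + 1 \<notin> \<int>\<^sub>\<le>\<^sub>0" "c + 2 \<notin> \<int>\<^sub>\<le>\<^sub>0" "c + 1 - \<mu> \<notin> \<int>\<^sub>\<le>\<^sub>0" "c + 2 - \<mu> \<notin> \<int>\<^sub>\<le>\<^sub>0"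
      using notin_nonpos_Ints_add_one[of c] notin_nonpos_Ints_add_one[of "c + 1"]
        notin_nonpos_Ints_add_one[of "c - \<mu>"] notin_nonpos_Ints_add_one[of "c + 1 - \<mu>"] Suc.prems(2,3)
      by (auto simp: algebra_simps)
    show ?case
    proof (rule frac_integral_hyp2F1_step[OF Suc.prems(2-)])
      show "(LINT y:{x<..<1}|lborel. frac_weight a \<mu> x y * hyp2F1 a (b + 1) (c + 1) (of_real y)) =
        Gamma \<mu> * frac_const a (b + 1) (c + 1) \<mu> * of_real (1 - x) powr (a - 1) *
        hyp2F1 (a - \<mu>) (b + 1) (c + 1 - \<mu>) (of_real x)"
        by (rule Suc.IH) (use c1 Suc.prems in simp_all)
      show "(LINT y:{x<..<1}|lborel. frac_weight (a + 1) \<mu> x y * hyp2F1 (a + 1) (b + 2) (c + 2) (of_real y)) =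
        Gamma \<mu> * frac_const (a + 1) (b + 2) (c + 2) \<mu> * of_real (1 - x) powr (a + 1 - 1) *
        hyp2F1 (a + 1 - \<mu>) (b + 2) (c + 2 - \<mu>) (of_real x)"
        by (rule Suc.IH) (use c1 Suc.prems in simp_all)
    qed
  qed
qed

text \<open>Integrability is asserted alongside the value because the integral of a non-integrable
  function is 0 by convention, so the equation alone would not express convergence.\<close>

theorem mainTheorem4:
  fixes a b c \<mu> :: complex and x :: real
  assumes "c \<notin> \<int>\<^sub>\<le>\<^sub>0" and "c - \<mu> \<notin> \<int>\<^sub>\<le>\<^sub>0"
    and "Re a > Re \<mu>" and "Re \<mu> > 0" and "Re (c - b) > Re \<mu>"
    and "x < 1"
  shows "set_integrable lborel {x<..<1}
           (\<lambda>y. of_real (1 - y) powr (a - \<mu> - 1) * hyp2F1 a b c (of_real y) *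
                 (of_real (y - x) powr (\<mu> - 1) / Gamma \<mu>))
       \<and> (LINT y:{x<..<1}|lborel.
            of_real (1 - y) powr (a - \<mu> - 1) * hyp2F1 a b c (of_real y) *
            (of_real (y - x) powr (\<mu> - 1) / Gamma \<mu>))
         = Gamma (a - \<mu>) / Gamma a * (Gamma (c - b - \<mu>) / Gamma (c - b)) *
           (Gamma c / Gamma (c - \<mu>)) * of_real (1 - x) powr (a - 1) *
           hyp2F1 (a - \<mu>) b (c - \<mu>) (of_real x)"
proof -
  have G: "Gamma \<mu> \<noteq> 0"
    using Re_pos_imp_notin_nonpos_Ints[OF assms(4)] by (simp add: Gamma_eq_zero_iff)
  have eq: "(\<lambda>y. of_real (1 - y) powr (a - \<mu> - 1) * hyp2F1 a b c (of_real y) *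
        (of_real (y - x) powr (\<mu> - 1) / Gamma \<mu>)) =
      (\<lambda>y. inverse (Gamma \<mu>) * (frac_weight a \<mu> x y * hyp2F1 a b c (of_real y)))"
    by (simp add: frac_weight_def fun_eq_iff field_simps)
  show ?thesis
    unfolding eq set_integral_mult_right frac_integral_hyp2F1[OF assms]
    using G set_integrable_frac_weight_hyp2F1[OF assms(1,3-6)]
    by (auto simp: frac_const_def intro!: set_integrable_mult_right)
qed

end
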